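(* Let $G$ be a finite simple outerplanar graph and let $\Delta$ be the maximum degree of a vertex in $G$. Then $G$ has a $(\Delta+2,2)$-incidence coloring.
   Context: A graph is outerplanar if it can be embedded in the plane without crossing edges in such a way that all the vertices are on the boundary of the exterior (unbounded) region. Connectedness is not assumed. An incidence of a simple graph $G$ is a pair $(v, vw)$ consisting of an edge $vw$ of $G$ and one of its endpoints $v$ (so each edge $vw$ gives two incidences, $(v,vw)$ and $(w,wv)$). Two distinct incidences $(v,vw)$ and $(\hat{v},\hat{v}\hat{w})$ are adjacent if $v=\hat{v}$, or $w=\hat{v}$, or $v=\hat{w}$. A $(k,l)$-incidence coloring of $G$ is an assignment of colors to all incidences of $G$, using at most $k$ colors in total, such that (i) it is proper, i.e. any two distinct adjacent incidences receive different colors, and (ii) for every vertex $v$ of $G$, the number of distinct colors used on the incidences $(u,uv)$, where $u$ ranges over all neighbours of $v$, is at most $l$. *)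

theory Defs
  imports "HOL-Analysis.Analysis"
begin

definition finite_simple_graph :: "'a set \<Rightarrow> 'a set set \<Rightarrow> bool" where
  "finite_simple_graph V E \<longleftrightarrow> finite V \<and> (\<forall>e\<in>E. e \<subseteq> V \<and> card e = 2)"

definition degree :: "'a set set \<Rightarrow> 'a \<Rightarrow> nat" where
  "degree E v = card {e \<in> E. v \<in> e}"

(* For finite V the supremum is the maximum; it is 0 for the graph without vertices. *)
definition max_degree :: "'a set \<Rightarrow> 'a set set \<Rightarrow> nat" where
  "max_degree V E = (SUP v\<in>V. degree E v)"

(* The plane is the type complex.  The vertex v is the point p v, and the edge e is the Jordan
   arc g e, in either direction of traversal.  An arc meets the vertices only in its two ends, and
   two arcs meet only in the images of common ends. *)
definition plane_embedding ::
  "'a set \<Rightarrow> 'a set set \<Rightarrow> ('a \<Rightarrow> complex) \<Rightarrow> ('a set \<Rightarrow> real \<Rightarrow> complex) \<Rightarrow> bool" where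
  "plane_embedding V E p g \<longleftrightarrow>
     inj_on p V \<and>
     (\<forall>e\<in>E. arc (g e) \<and> {pathstart (g e), pathfinish (g e)} = p ` e) \<and>
     (\<forall>e\<in>E. \<forall>v\<in>V. p v \<in> path_image (g e) \<longrightarrow> v \<in> e) \<and>
     (\<forall>e\<in>E. \<forall>f\<in>E. e \<noteq> f \<longrightarrow> path_image (g e) \<inter> path_image (g f) \<subseteq> p ` (e \<inter> f))"

definition drawing ::
  "'a set \<Rightarrow> 'a set set \<Rightarrow> ('a \<Rightarrow> complex) \<Rightarrow> ('a set \<Rightarrow> real \<Rightarrow> complex) \<Rightarrow> complex set" where
  "drawing V E p g = p ` V \<union> (\<Union>e\<in>E. path_image (g e))"

(* The drawing of a finite graph is compact, so its outside is the unique unbounded connected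
   component of its complement, that is, the exterior region. *)
definition outerplanar :: "'a set \<Rightarrow> 'a set set \<Rightarrow> bool" where
  "outerplanar V E \<longleftrightarrow>
     (\<exists>p g. plane_embedding V E p g \<and> p ` V \<subseteq> frontier (outside (drawing V E p g)))"

definition incidences :: "'a set set \<Rightarrow> ('a \<times> 'a set) set" where
  "incidences E = {(v, e). e \<in> E \<and> v \<in> e}"

definition adjacent_incidences :: "'a \<times> 'a set \<Rightarrow> 'a \<times> 'a set \<Rightarrow> bool" where
  "adjacent_incidences i j \<longleftrightarrow>
     i \<noteq> j \<and>
     (\<exists>v w v' w'. i = (v, {v, w}) \<and> j = (v', {v', w'}) \<and> (v = v' \<or> w = v' \<or> v = w'))"

definition incidence_coloring ::
  "nat \<Rightarrow> nat \<Rightarrow> 'a set \<Rightarrow> 'a set set \<Rightarrow> ('a \<times> 'a set \<Rightarrow> 'c) \<Rightarrow> bool" where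
  "incidence_coloring k l V E c \<longleftrightarrow>
     card (c ` incidences E) \<le> k \<and>
     (\<forall>i\<in>incidences E. \<forall>j\<in>incidences E. adjacent_incidences i j \<longrightarrow> c i \<noteq> c j) \<and>
     (\<forall>v\<in>V. card {c (u, {u, v}) | u. {u, v} \<in> E} \<le> l)"

end

theory Submission
  imports Defs
begin

text \<open>
  Regard the incidence \<open>(v, vw)\<close> as the arc from \<open>v\<close> to \<open>w\<close>. Two incidences are adjacent exactly when
  their arcs have a common tail or when one ends where the other starts. All conditions are therefore
  local: at each vertex the arcs leaving it have distinct colors, and no arc entering it has the
  color of an arc leaving it. Give each vertex \<open>v\<close> a set \<open>P v\<close> of two colors, out of \<open>k + 2\<close> with
  \<open>k = \<Delta>\<close>, that contains the colors of all arcs entering \<open>v\<close>. There remain \<open>k\<close> colors for the at most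
  \<open>k\<close> arcs leaving \<open>v\<close>, so that a vertex with one edge still to be colored always has a free color for
  the arc along that edge.

  Such a coloring is built by adding vertices one or two at a time. It extends to a vertex of degree
  at most 1 (\<open>extend_leaf\<close>), to a vertex of degree 2 whose two neighbours are adjacent
  (\<open>extend_triangle\<close>), and to two adjacent vertices of degree 2 (\<open>extend_two_adjacent\<close>). Hence it is
  enough that each nonempty set of vertices of an outerplanar graph induces a graph in which one of
  these three configurations occurs; this is \<open>reducible_if_no_theta_no_crossing\<close>.

  That lemma uses outerplanarity only through two consequences. No two vertices are joined by three
  internally disjoint paths all of which have interior vertices (\<open>outerplanar_no_theta\<close>), and no two
  chords of a cycle cross (\<open>outerplanar_no_crossing\<close>). Suppose that all degrees are at least 2. A
  smallest vertex set \<open>S\<close> that is attached to the rest at only one vertex \<open>r\<close> plays the part of a leaf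
  block. A longest cycle in \<open>S \<union> {r}\<close> passes through all its vertices, because an ear would give
  either a longer cycle or three forbidden paths. Number the cycle from \<open>r\<close> and take a chord that spans
  the fewest vertices, the closing edge of the cycle counting as a chord. The vertices
  strictly below it are not \<open>r\<close>, so their neighbours are on the cycle, and a further edge at one of them
  would cross the chord or span less; hence they have degree 2. If there is one of
  them, it lies in a triangle; if there are more, two of them are adjacent.

  The two consequences are topological. The vertices lie on the frontier of the outside of the
  drawing, so no vertex is inside a closed curve of the drawing (\<open>vertex_not_inside\<close>). But in a theta
  curve one of the three arcs passes through the inside of the closed curve that the other two form
  (\<open>theta_arc_inside\<close>, from Janiszewski's theorem), and its vertices would be there with it. If two
  chords of a cycle cross, then by the same lemma both pass through the inside of the cycle. The first
  divides this inside into two parts, and the second stays in one of them, whose frontier contains only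
  one of its two ends (\<open>chords_inside_cross\<close>).
\<close>

section \<open>Colorings of arcs with two entering colors per vertex\<close>

definition nbrs :: "('a \<Rightarrow> 'a \<Rightarrow> bool) \<Rightarrow> 'a set \<Rightarrow> 'a \<Rightarrow> 'a set" where
  "nbrs adj U v = {w \<in> U. adj v w}"

text \<open>
  Here \<open>c u w\<close> is the color of the arc from \<open>u\<close> to \<open>w\<close>, that is, of the incidence \<open>(u, uw)\<close>. The set
  \<open>P v\<close> contains the colors entering \<open>v\<close>. It is required to have exactly two elements, whatever the
  degree of \<open>v\<close>, so that the number of colors left for the arcs leaving \<open>v\<close> is always \<open>k\<close>.
\<close>

definition arc_coloring ::
  "('a \<Rightarrow> 'a \<Rightarrow> bool) \<Rightarrow> nat \<Rightarrow> 'a set \<Rightarrow> ('a \<Rightarrow> nat set) \<Rightarrow> ('a \<Rightarrow> 'a \<Rightarrow> nat) \<Rightarrow> bool" where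
  "arc_coloring adj k U P c \<longleftrightarrow> (\<forall>v\<in>U. card (P v) = 2 \<and> P v \<subseteq> {..<k + 2} \<and>
     inj_on (c v) (nbrs adj U v) \<and> (\<forall>w\<in>nbrs adj U v. c v w \<in> P w - P v))"

lemma nbrs_mono: "U \<subseteq> W \<Longrightarrow> nbrs adj U v \<subseteq> nbrs adj W v"
  by (auto simp: nbrs_def)

lemma color_avoiding:
  fixes n :: nat
  assumes "finite F" "card F < n"
  obtains a where "a < n" "a \<notin> F"
proof -
  have "\<not> {..<n} \<subseteq> F" using card_mono[OF assms(1), of "{..<n}"] assms(2) by auto
  then show ?thesis using that by blast
qed

text \<open>
  This chooses the set of entering colors of a new vertex: \<open>a\<close> and \<open>b\<close> are to enter it, the colors in
  \<open>F\<close> are to leave it.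
\<close>

lemma color_pair_avoiding:
  fixes n :: nat
  assumes "finite F" "card F + 1 < n" "a < n" "b < n" "a \<notin> F" "b \<notin> F"
  obtains Q where "card Q = 2" "Q \<subseteq> {..<n}" "a \<in> Q" "b \<in> Q" "Q \<inter> F = {}"
proof (cases "a = b")
  case True
  have "card (insert a F) < n" using assms(1,2) by (simp add: card_insert_if)
  then obtain d where "d < n" "d \<notin> insert a F"
    using color_avoiding[of "insert a F" n] assms(1) by auto
  then show ?thesis using that[of "{a, d}"] assms True by auto
next
  case False
  then show ?thesis using that[of "{a, b}"] assms by auto
qed

text \<open>
  All conditions on a coloring concern the arcs at one vertex. To add \<open>v\<close> it therefore suffices to look
  at \<open>v\<close> and at its neighbours \<open>x\<close>, where the arc from \<open>x\<close> to \<open>v\<close> gets the color \<open>f x\<close> and the arc from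
  \<open>v\<close> to \<open>x\<close> the color \<open>h x\<close>.
\<close>

lemma arc_coloring_insert:
  assumes sym: "\<And>u v. adj u v \<Longrightarrow> adj v u" and irrefl: "\<And>u. \<not> adj u u"
    and col: "arc_coloring adj k U P c" and v: "v \<notin> U" "nbrs adj U v = X"
    and Q: "card Q = 2" "Q \<subseteq> {..<k + 2}"
    and f: "\<And>x. x \<in> X \<Longrightarrow> f x \<in> Q \<and> f x \<notin> P x \<and> f x \<notin> c x ` nbrs adj U x"
    and h: "inj_on h X" "\<And>x. x \<in> X \<Longrightarrow> h x \<in> P x - Q"
  shows "arc_coloring adj k (insert v U) (P(v := Q)) (\<lambda>u w. if u = v then h w else if w = v then f u else c u w)"
    (is "arc_coloring adj k _ ?P ?c")
  unfolding arc_coloring_def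
proof
  fix u assume u: "u \<in> insert v U"
  show "card (?P u) = 2 \<and> ?P u \<subseteq> {..<k + 2} \<and> inj_on (?c u) (nbrs adj (insert v U) u) \<and>
    (\<forall>w\<in>nbrs adj (insert v U) u. ?c u w \<in> ?P w - ?P u)"
  proof (cases "u = v")
    case True
    have "nbrs adj (insert v U) v = X" using v irrefl by (auto simp: nbrs_def)
    moreover have "v \<notin> X" using v by (auto simp: nbrs_def)
    ultimately show ?thesis using True Q h by (auto simp: inj_on_def)
  next
    case False
    then have uU: "u \<in> U" using u by simp
    have old: "card (P u) = 2" "P u \<subseteq> {..<k + 2}" "inj_on (c u) (nbrs adj U u)"
      "\<And>w. w \<in> nbrs adj U u \<Longrightarrow> c u w \<in> P w - P u"
      using col uU by (auto simp: arc_coloring_def)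
    have vn: "v \<notin> nbrs adj U u" using v by (simp add: nbrs_def)
    have inj: "inj_on (?c u) (nbrs adj U u)"
      using old(3) vn False by (auto simp: inj_on_def)
    show ?thesis
    proof (cases "adj u v")
      case True
      then have uX: "u \<in> X" using uU v(2) sym by (auto simp: nbrs_def)
      have nb: "nbrs adj (insert v U) u = insert v (nbrs adj U u)" using True by (auto simp: nbrs_def)
      have "f u \<notin> ?c u ` nbrs adj U u" using f[OF uX] vn False by (auto simp: image_iff)
      then show ?thesis unfolding nb using inj old f[OF uX] False vn by auto
    next
      case notadj: False
      then have nb: "nbrs adj (insert v U) u = nbrs adj U u" by (auto simp: nbrs_def)
      show ?thesis unfolding nb using inj old False vn by auto
    qed
  qed
qed

text \<open>
  The third configuration is two adjacent vertices \<open>v\<close> and \<open>w\<close> of degree 2. In the second one, \<open>v\<close> has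
  degree 2 and lies in a triangle, since an irreflexive \<open>adj\<close> makes \<open>x\<close> and \<open>y\<close> distinct.
\<close>

definition reducible :: "('a \<Rightarrow> 'a \<Rightarrow> bool) \<Rightarrow> 'a set \<Rightarrow> bool" where
  "reducible adj U \<longleftrightarrow>
     (\<exists>v\<in>U. card (nbrs adj U v) \<le> 1) \<or>
     (\<exists>v\<in>U. \<exists>x y. adj x y \<and> nbrs adj U v = {x, y}) \<or>
     (\<exists>v\<in>U. \<exists>w\<in>U. \<exists>x y. x \<noteq> w \<and> v \<noteq> y \<and> nbrs adj U v = {x, w} \<and> nbrs adj U w = {v, y})"

context
  fixes adj :: "'a \<Rightarrow> 'a \<Rightarrow> bool" and k :: nat and V :: "'a set"
  assumes sym: "\<And>u v. adj u v \<Longrightarrow> adj v u" and irrefl: "\<And>u. \<not> adj u u"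
    and fin: "finite V" and deg: "\<And>v. v \<in> V \<Longrightarrow> card (nbrs adj V v) \<le> k"
begin

lemma finite_nbrs: "U \<subseteq> V \<Longrightarrow> finite (nbrs adj U v)"
  using fin by (simp add: nbrs_def finite_subset)

lemma deg_mono: "U \<subseteq> V \<Longrightarrow> v \<in> V \<Longrightarrow> card (nbrs adj U v) \<le> k"
  using card_mono[OF finite_nbrs[of V v], of "nbrs adj U v"] deg[of v]
  by (meson nbrs_mono order_trans subset_refl)

text \<open>
  As \<open>x\<close> has the neighbour \<open>v\<close> outside \<open>U\<close>, at most \<open>k - 1\<close> arcs leaving \<open>x\<close> are colored. Together with
  the two colors of \<open>P x\<close> they exclude at most \<open>k + 1\<close> of the \<open>k + 2\<close> colors.
\<close>

lemma free_out_color: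
  assumes col: "arc_coloring adj k U P c" and U: "U \<subseteq> V" "x \<in> U" and v: "v \<in> V - U" "adj x v"
  obtains \<alpha> where "\<alpha> < k + 2" "\<alpha> \<notin> P x" "\<alpha> \<notin> c x ` nbrs adj U x"
proof -
  have "insert v (nbrs adj U x) \<subseteq> nbrs adj V x" using U v by (auto simp: nbrs_def)
  then have "card (insert v (nbrs adj U x)) \<le> k"
    using card_mono[OF finite_nbrs[of V x]] deg[of x] U by (meson order_trans subset_iff subset_refl)
  moreover have "v \<notin> nbrs adj U x" using v by (simp add: nbrs_def)
  ultimately have "card (nbrs adj U x) < k" using finite_nbrs[OF U(1)] by simp
  then have "card (c x ` nbrs adj U x) < k" using card_image_le[OF finite_nbrs[OF U(1)]] le_less_trans by blast
  moreover have P: "card (P x) = 2" using col U by (simp add: arc_coloring_def)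
  ultimately have "card (P x \<union> c x ` nbrs adj U x) < k + 2"
    using card_Un_le[of "P x" "c x ` nbrs adj U x"] by linarith
  moreover have "finite (P x \<union> c x ` nbrs adj U x)"
    using P finite_nbrs[OF U(1)] by (simp add: card_ge_0_finite)
  ultimately show ?thesis using color_avoiding that by (metis UnI1 UnI2)
qed

lemma extend_leaf:
  assumes col: "arc_coloring adj k U P c" and U: "U \<subseteq> V" "v \<in> V - U" and leaf: "card (nbrs adj U v) \<le> 1"
  shows "\<exists>P c. arc_coloring adj k (insert v U) P c"
proof (cases "nbrs adj U v = {}")
  case True
  have "arc_coloring adj k (insert v U) (P(v := {0, 1})) (\<lambda>u w. if u = v then 0 else if w = v then 0 else c u w)"
    by (rule arc_coloring_insert[OF sym irrefl col _ True]) (use U in auto)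
  then show ?thesis by blast
next
  case False
  then obtain x where X: "nbrs adj U v = {x}"
    using leaf finite_nbrs[OF U(1)] by (metis One_nat_def card_0_eq card_1_singletonE le_Suc_eq le_zero_eq)
  then have x: "x \<in> U" "adj v x" by (auto simp: nbrs_def)
  obtain \<alpha> where \<alpha>: "\<alpha> < k + 2" "\<alpha> \<notin> P x" "\<alpha> \<notin> c x ` nbrs adj U x"
    using free_out_color[OF col U(1) x(1) U(2) sym[OF x(2)]] .
  have P: "card (P x) = 2" using col x by (simp add: arc_coloring_def)
  then obtain a where a: "a \<in> P x" by fastforce
  have "card (nbrs adj V v) \<noteq> 0" using x U finite_nbrs[of V v] by (auto simp: nbrs_def)
  then have "card {a} + 1 < k + 2" using deg[of v] U by auto
  then obtain Q where Q: "card Q = 2" "Q \<subseteq> {..<k + 2}" "\<alpha> \<in> Q" "\<alpha> \<in> Q" "Q \<inter> {a} = {}"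
    using color_pair_avoiding[of "{a}" "k + 2" \<alpha> \<alpha>] \<alpha>(1,2) a by blast
  have "arc_coloring adj k (insert v U) (P(v := Q)) (\<lambda>u w. if u = v then a else if w = v then \<alpha> else c u w)"
    by (rule arc_coloring_insert[OF sym irrefl col _ X Q(1,2)]) (use U Q \<alpha> a in auto)
  then show ?thesis by blast
qed

text \<open>
  The arcs entering \<open>v\<close> get free colors \<open>\<alpha>\<close> and \<open>\<beta>\<close> of \<open>x\<close> and \<open>y\<close>. The arcs leaving \<open>v\<close> need
  distinct colors in \<open>P x - {\<beta>}\<close> and \<open>P y - {\<alpha>}\<close>. This could only fail if both were the same
  singleton, and the color of the arc from \<open>x\<close> to \<open>y\<close> rules that out: it lies in \<open>P y\<close> but not in \<open>P x\<close>,
  and it differs from \<open>\<alpha>\<close> because \<open>\<alpha>\<close> is free at \<open>x\<close>.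
\<close>

lemma extend_triangle:
  assumes col: "arc_coloring adj k U P c" and U: "U \<subseteq> V" "v \<in> V - U"
    and X: "nbrs adj U v = {x, y}" and xy: "adj x y"
  shows "\<exists>P c. arc_coloring adj k (insert v U) P c"
proof -
  have x: "x \<in> U" "adj v x" and y: "y \<in> U" "adj v y" using X by (auto simp: nbrs_def)
  have ne: "x \<noteq> y" using xy irrefl by metis
  obtain \<alpha> where \<alpha>: "\<alpha> < k + 2" "\<alpha> \<notin> P x" "\<alpha> \<notin> c x ` nbrs adj U x"
    using free_out_color[OF col U(1) x(1) U(2) sym[OF x(2)]] .
  obtain \<beta> where \<beta>: "\<beta> < k + 2" "\<beta> \<notin> P y" "\<beta> \<notin> c y ` nbrs adj U y"
    using free_out_color[OF col U(1) y(1) U(2) sym[OF y(2)]] .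
  have P: "card (P x) = 2" "card (P y) = 2" using col x y by (auto simp: arc_coloring_def)
  have other: "\<exists>b\<in>P z. b \<noteq> a" if "card (P z) = 2" for a z
    using that by (auto simp: card_2_iff)
  have "y \<in> nbrs adj U x" using xy y by (simp add: nbrs_def)
  then have cxy: "c x y \<in> P y - P x" "c x y \<noteq> \<alpha>" using col x \<alpha>(3) by (auto simp: arc_coloring_def)
  have "\<exists>a b. a \<in> P x \<and> b \<in> P y \<and> a \<noteq> b \<and> a \<noteq> \<beta> \<and> b \<noteq> \<alpha>"
  proof -
    obtain a where a: "a \<in> P x" "a \<noteq> \<beta>" using other[OF P(1)] by blast
    obtain b where b: "b \<in> P y" "b \<noteq> \<alpha>" using other[OF P(2)] by blast
    show ?thesis
    proof (cases "a = b")
      case True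
      \<comment> \<open>the color of the arc from \<open>x\<close> to \<open>y\<close> is not in \<open>P x\<close>, so it differs from \<open>a\<close>\<close>
      then show ?thesis using a b cxy by (intro exI[of _ a] exI[of _ "c x y"]) auto
    next
      case False
      then show ?thesis using a b by blast
    qed
  qed
  then obtain a b where ab: "a \<in> P x" "b \<in> P y" "a \<noteq> b" "a \<noteq> \<beta>" "b \<noteq> \<alpha>" by blast
  have "card {x, y} \<le> k" using deg_mono[OF U(1), of v] U X by simp
  then have "card {a, b} + 1 < k + 2" using ne ab by simp
  moreover have "\<alpha> \<notin> {a, b}" "\<beta> \<notin> {a, b}" using ab \<alpha> \<beta> by auto
  ultimately obtain Q where Q: "card Q = 2" "Q \<subseteq> {..<k + 2}" "\<alpha> \<in> Q" "\<beta> \<in> Q" "Q \<inter> {a, b} = {}"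
    using color_pair_avoiding[of "{a, b}" "k + 2" \<alpha> \<beta>] \<alpha>(1) \<beta>(1) by blast
  have "arc_coloring adj k (insert v U) (P(v := Q)) (\<lambda>u w. if u = v then (if w = x then a else b)
      else if w = v then (if u = x then \<alpha> else \<beta>) else c u w)"
    by (rule arc_coloring_insert[OF sym irrefl col _ X Q(1,2)]) (use U Q \<alpha> \<beta> ab ne in auto)
  then show ?thesis by blast
qed

text \<open>
  The path \<open>x, v, w, y\<close> is added between \<open>x\<close> and \<open>y\<close>. The arcs from \<open>x\<close> to \<open>v\<close> and from \<open>y\<close> to \<open>w\<close> get
  free colors \<open>\<alpha>\<close> and \<open>\<beta>\<close>, the arcs back to \<open>x\<close> and \<open>y\<close> get \<open>a\<close> and \<open>b\<close>, and the arcs from \<open>w\<close> to \<open>v\<close>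
  and from \<open>v\<close> to \<open>w\<close> get \<open>\<gamma>\<close> and \<open>\<delta>\<close>. At most \<open>card {a, b} + 2\<close> colors are excluded for each of \<open>\<gamma>\<close>
  and \<open>\<delta>\<close>, which is why \<open>card {a, b} < k\<close> suffices.
\<close>

lemma extend_two_adjacent:
  assumes col: "arc_coloring adj k U P c" and U: "U \<subseteq> V" "v \<in> V - U" "w \<in> V - U"
    and X: "nbrs adj U w = {y}" "nbrs adj (insert w U) v = {x, w}" and ne: "v \<noteq> w" "x \<noteq> y" "x \<noteq> w"
    and ab: "a \<in> P x" "b \<in> P y" "card {a, b} < k"
  shows "\<exists>P c. arc_coloring adj k (insert v (insert w U)) P c"
proof -
  have x: "x \<in> U" "adj v x" and y: "y \<in> U" "adj w y" and vw: "adj v w"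
    using X ne by (auto simp: nbrs_def)
  obtain \<alpha> where \<alpha>: "\<alpha> < k + 2" "\<alpha> \<notin> P x" "\<alpha> \<notin> c x ` nbrs adj U x"
    using free_out_color[OF col U(1) x(1) U(2) sym[OF x(2)]] .
  obtain \<beta> where \<beta>: "\<beta> < k + 2" "\<beta> \<notin> P y" "\<beta> \<notin> c y ` nbrs adj U y"
    using free_out_color[OF col U(1) y(1) U(3) sym[OF y(2)]] .
  have "card {\<beta>, a, b} < k + 2" using ab(3) by (simp add: card_insert_if)
  then obtain \<gamma> where \<gamma>: "\<gamma> < k + 2" "\<gamma> \<notin> {\<beta>, a, b}" using color_avoiding[of "{\<beta>, a, b}"] by blast
  have "card {\<alpha>, \<gamma>, a, b} < k + 2" using ab(3) by (simp add: card_insert_if)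
  then obtain \<delta> where \<delta>: "\<delta> < k + 2" "\<delta> \<notin> {\<alpha>, \<gamma>, a, b}" using color_avoiding[of "{\<alpha>, \<gamma>, a, b}"] by blast
  have k: "2 \<le> k" using ab(3) by (auto simp: card_insert_if split: if_splits)
  have "card {\<gamma>, b} + 1 < k + 2" "card {a, \<delta>} + 1 < k + 2" using k by (simp_all add: card_insert_if)
  note card = this
  have "\<beta> \<notin> {\<gamma>, b}" "\<delta> \<notin> {\<gamma>, b}" using \<beta> \<gamma> \<delta> ab by auto
  then obtain Qw where Qw: "card Qw = 2" "Qw \<subseteq> {..<k + 2}" "\<beta> \<in> Qw" "\<delta> \<in> Qw" "Qw \<inter> {\<gamma>, b} = {}"
    using color_pair_avoiding[of "{\<gamma>, b}" "k + 2" \<beta> \<delta>] card(1) \<beta>(1) \<delta>(1) by blast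
  have "\<alpha> \<notin> {a, \<delta>}" "\<gamma> \<notin> {a, \<delta>}" using \<alpha> \<gamma> \<delta> ab by auto
  then obtain Qv where Qv: "card Qv = 2" "Qv \<subseteq> {..<k + 2}" "\<alpha> \<in> Qv" "\<gamma> \<in> Qv" "Qv \<inter> {a, \<delta>} = {}"
    using color_pair_avoiding[of "{a, \<delta>}" "k + 2" \<alpha> \<gamma>] card(2) \<alpha>(1) \<gamma>(1) by blast
  define c1 where "c1 = (\<lambda>u z. if u = w then b else if z = w then \<beta> else c u z)"
  have col1: "arc_coloring adj k (insert w U) (P(w := Qw)) c1"
    unfolding c1_def by (rule arc_coloring_insert[OF sym irrefl col _ X(1) Qw(1,2)]) (use U Qw \<beta> ab in auto)
  have nx: "nbrs adj (insert w U) x = nbrs adj U x"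
    using X(1) x(1) ne sym unfolding nbrs_def by blast
  have nw: "nbrs adj (insert w U) w = {y}" using X(1) irrefl unfolding nbrs_def by blast
  have wn: "w \<notin> nbrs adj U x" using U by (simp add: nbrs_def)
  have c1x: "c1 x ` nbrs adj U x = c x ` nbrs adj U x"
    using wn ne by (intro image_cong) (auto simp: c1_def)
  have "arc_coloring adj k (insert v (insert w U)) (P(w := Qw, v := Qv))
     (\<lambda>u z. if u = v then (if z = x then a else \<delta>) else if z = v then (if u = x then \<alpha> else \<gamma>) else c1 u z)"
  proof (rule arc_coloring_insert[OF sym irrefl col1 _ X(2) Qv(1,2)])
    have "\<alpha> \<in> Qv \<and> \<alpha> \<notin> (P(w := Qw)) x \<and> \<alpha> \<notin> c1 x ` nbrs adj (insert w U) x"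
      unfolding nx c1x using Qv(3) \<alpha>(2,3) ne(3) by simp
    moreover have "\<gamma> \<in> Qv \<and> \<gamma> \<notin> (P(w := Qw)) w \<and> \<gamma> \<notin> c1 w ` nbrs adj (insert w U) w"
      unfolding nw using Qv(4) Qw(5) \<gamma>(2) by (auto simp: c1_def)
    ultimately show "(if z = x then \<alpha> else \<gamma>) \<in> Qv \<and> (if z = x then \<alpha> else \<gamma>) \<notin> (P(w := Qw)) z \<and>
      (if z = x then \<alpha> else \<gamma>) \<notin> c1 z ` nbrs adj (insert w U) z" if "z \<in> {x, w}" for z
      using that by (cases "z = x") simp_all
    show "inj_on (\<lambda>z. if z = x then a else \<delta>) {x, w}" using \<delta>(2) by (auto simp: inj_on_def)
    show "(if z = x then a else \<delta>) \<in> (P(w := Qw)) z - Qv" if "z \<in> {x, w}" for z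
      using that ab(1) Qv(5) Qw(4) ne(3) by (cases "z = x") auto
    show "v \<notin> insert w U" using U ne(1) by simp
  qed
  then show ?thesis by blast
qed

text \<open>
  At most one arc enters \<open>x\<close>, so at most one element of \<open>P x\<close> is in use. Another one can be exchanged for any
  color that does not leave \<open>x\<close>.
\<close>

lemma recolor_in_pair:
  assumes col: "arc_coloring adj k U P c" and U: "U \<subseteq> V" "x \<in> U" and one: "card (nbrs adj U x) \<le> 1"
    and a: "a < k + 2" "a \<notin> c x ` nbrs adj U x"
  obtains Q where "arc_coloring adj k U (P(x := Q)) c" "a \<in> Q"
proof (cases "a \<in> P x")
  case True
  then show ?thesis using that[of "P x"] col by simp
next
  case False
  have Px: "card (P x) = 2" "P x \<subseteq> {..<k + 2}" using col U by (auto simp: arc_coloring_def)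
  have "\<exists>q\<in>P x. \<forall>z\<in>nbrs adj U x. c z x = q"
  proof (cases "nbrs adj U x = {}")
    case True
    moreover have "P x \<noteq> {}" using Px by auto
    ultimately show ?thesis by blast
  next
    case False
    then obtain z where z: "nbrs adj U x = {z}"
      using one finite_nbrs[OF U(1)] by (metis One_nat_def card_0_eq card_1_singletonE le_Suc_eq le_zero_eq)
    then have "z \<in> U" "x \<in> nbrs adj U z" using U sym unfolding nbrs_def by blast+
    then have "c z x \<in> P x" using col by (auto simp: arc_coloring_def)
    then show ?thesis using z by auto
  qed
  then obtain q where q: "q \<in> P x" "\<And>z. z \<in> nbrs adj U x \<Longrightarrow> c z x = q" by blast
  have "card {q, a} = 2" using q(1) False by (cases "q = a") auto
  have "arc_coloring adj k U (P(x := {q, a})) c"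
    unfolding arc_coloring_def
  proof
    fix u assume u: "u \<in> U"
    have old: "card (P u) = 2" "P u \<subseteq> {..<k + 2}" "inj_on (c u) (nbrs adj U u)"
      "\<And>w. w \<in> nbrs adj U u \<Longrightarrow> c u w \<in> P w - P u"
      using col u by (auto simp: arc_coloring_def)
    have "c u w \<in> (P(x := {q, a})) w - (P(x := {q, a})) u" if w: "w \<in> nbrs adj U u" for w
    proof (cases "u = x")
      case True
      then have "w \<noteq> x" using w irrefl by (auto simp: nbrs_def)
      then show ?thesis using True old(4)[OF w] q(1) a(2) w by auto
    next
      case False
      show ?thesis
      proof (cases "w = x")
        case True
        then have "u \<in> nbrs adj U x" using w u sym unfolding nbrs_def by blast
        then show ?thesis using True False q(2)[of u] old(4)[OF w] by auto
      qed (use False old(4)[OF w] in auto)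
    qed
    then show "card ((P(x := {q, a})) u) = 2 \<and> (P(x := {q, a})) u \<subseteq> {..<k + 2} \<and> inj_on (c u) (nbrs adj U u) \<and>
      (\<forall>w\<in>nbrs adj U u. c u w \<in> (P(x := {q, a})) w - (P(x := {q, a})) u)"
      using old Px q(1) a(1) \<open>card {q, a} = 2\<close> by auto
  qed
  then show ?thesis using that by blast
qed

text \<open>
  For \<open>k \<ge> 3\<close> any \<open>a\<close> and \<open>b\<close> will do. For \<open>k = 2\<close> they have to be equal, and then \<open>P x\<close> and \<open>P y\<close> are
  first changed to share a color that leaves neither \<open>x\<close> nor \<open>y\<close>.
\<close>

lemma common_in_color:
  assumes col: "arc_coloring adj k U P c" and U: "U \<subseteq> V" "x \<in> U" "y \<in> U" and ne: "x \<noteq> y" and k: "2 \<le> k"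
    and low: "k = 2 \<Longrightarrow> card (nbrs adj U x) \<le> 1 \<and> card (nbrs adj U y) \<le> 1"
  obtains P' a b where "arc_coloring adj k U P' c" "a \<in> P' x" "b \<in> P' y" "card {a, b} < k"
proof (cases "k = 2")
  case False
  have "card (P x) = 2" "card (P y) = 2" using col U by (auto simp: arc_coloring_def)
  then have "P x \<noteq> {}" "P y \<noteq> {}" by auto
  then obtain a b where ab: "a \<in> P x" "b \<in> P y" by blast
  have "card {a, b} < k" using k False by (simp add: card_insert_if)
  then show ?thesis using that[OF col ab] by blast
next
  case True
  note low = low[OF True]
  have "card (c x ` nbrs adj U x) \<le> 1" "card (c y ` nbrs adj U y) \<le> 1"
    using low card_image_le[OF finite_nbrs[OF U(1)]] le_trans by blast+
  then have "card (c x ` nbrs adj U x \<union> c y ` nbrs adj U y) < k + 2"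
    using True card_Un_le[of "c x ` nbrs adj U x" "c y ` nbrs adj U y"] by linarith
  moreover have "finite (c x ` nbrs adj U x \<union> c y ` nbrs adj U y)"
    by (simp add: finite_nbrs[OF U(1)])
  ultimately obtain a where "a < k + 2" "a \<notin> c x ` nbrs adj U x \<union> c y ` nbrs adj U y"
    using color_avoiding by metis
  then have a: "a < k + 2" "a \<notin> c x ` nbrs adj U x" "a \<notin> c y ` nbrs adj U y" by simp_all
  obtain Q where Q: "arc_coloring adj k U (P(x := Q)) c" "a \<in> Q"
    using recolor_in_pair[OF col U(1,2) conjunct1[OF low] a(1,2)] .
  obtain R where R: "arc_coloring adj k U (P(x := Q, y := R)) c" "a \<in> R"
    using recolor_in_pair[OF Q(1) U(1,3) conjunct2[OF low] a(1,3)] .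
  show ?thesis by (rule that[OF R(1), of a a]) (use Q R ne True in auto)
qed

lemma arc_coloring_exists:
  assumes red: "\<And>U. U \<subseteq> V \<Longrightarrow> U \<noteq> {} \<Longrightarrow> reducible adj U"
    and "U \<subseteq> V"
  shows "\<exists>P c. arc_coloring adj k U P c"
  using finite_subset[OF \<open>U \<subseteq> V\<close> fin] \<open>U \<subseteq> V\<close>
proof (induction U rule: finite_psubset_induct)
  case (psubset U)
  have nbrs_del: "nbrs adj (U - W) v = nbrs adj U v - W" for W v by (auto simp: nbrs_def)
  have self: "v \<notin> nbrs adj U v" for v using irrefl by (simp add: nbrs_def)
  have IH: "\<exists>P c. arc_coloring adj k (U - W) P c" if "W \<inter> U \<noteq> {}" for W
    using psubset.IH[of "U - W"] psubset.prems that by blast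
  show ?case
  proof (cases "U = {}")
    case True
    then show ?thesis by (simp add: arc_coloring_def)
  next
    case False
    consider (leaf) v where "v \<in> U" "card (nbrs adj U v) \<le> 1"
      | (triangle) v x y where "v \<in> U" "adj x y" "nbrs adj U v = {x, y}"
      | (adjacent) v w x y where "v \<in> U" "w \<in> U" "x \<noteq> w" "v \<noteq> y" "x \<noteq> y"
          "nbrs adj U v = {x, w}" "nbrs adj U w = {v, y}"
    proof -
      have "adj x w" if "nbrs adj U w = {v, x}" for v w x
        using that sym unfolding nbrs_def by blast
      then show ?thesis
        using red[OF psubset.prems False] leaf triangle adjacent unfolding reducible_def by metis
    qed
    then show ?thesis
    proof cases
      case leaf
      then obtain P c where "arc_coloring adj k (U - {v}) P c" using IH[of "{v}"] by blast
      then have "\<exists>P c. arc_coloring adj k (insert v (U - {v})) P c"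
        by (rule extend_leaf) (use leaf psubset.prems self in \<open>auto simp: nbrs_del\<close>)
      then show ?thesis using leaf(1) by (simp add: insert_absorb)
    next
      case triangle
      then obtain P c where "arc_coloring adj k (U - {v}) P c" using IH[of "{v}"] by blast
      then have "\<exists>P c. arc_coloring adj k (insert v (U - {v})) P c"
        by (rule extend_triangle[of _ _ _ _ x y]) (use triangle psubset.prems self[of v] in \<open>auto simp: nbrs_del\<close>)
      then show ?thesis using triangle(1) by (simp add: insert_absorb)
    next
      case adjacent
      let ?U = "U - {v, w}"
      have "v \<noteq> w" "v \<noteq> x" "w \<noteq> y" using adjacent self[of v] self[of w] by auto
      have xy: "x \<in> U" "y \<in> U" "adj v x" "adj w y" using adjacent by (auto simp: nbrs_def)
      have vx: "v \<in> nbrs adj U x" and wy: "w \<in> nbrs adj U y"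
        using xy adjacent(1,2) sym unfolding nbrs_def by blast+
      obtain P c where col: "arc_coloring adj k ?U P c" using IH[of "{v, w}"] adjacent(1) by blast
      have "card {x, w} \<le> k" using deg_mono[OF psubset.prems, of v] adjacent psubset.prems by auto
      then have k: "2 \<le> k" using adjacent by simp
      have UV: "?U \<subseteq> V" using psubset.prems by blast
      have low: "card (nbrs adj ?U u) < k" if "u \<in> U" "z \<in> nbrs adj U u" "z \<in> {v, w}" for u z
      proof -
        have "nbrs adj ?U u \<subset> nbrs adj U u" using that by (auto simp: nbrs_def)
        then have "card (nbrs adj ?U u) < card (nbrs adj U u)"
          by (rule psubset_card_mono[OF finite_nbrs[OF psubset.prems]])
        then show ?thesis using deg_mono[OF psubset.prems, of u] that(1) psubset.prems by force
      qed
      obtain P' a b where "arc_coloring adj k ?U P' c" "a \<in> P' x" "b \<in> P' y" "card {a, b} < k"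
      proof (rule common_in_color[OF col UV _ _ adjacent(5) k])
        show "x \<in> ?U" "y \<in> ?U" using xy adjacent \<open>v \<noteq> x\<close> \<open>w \<noteq> y\<close> by auto
        show "card (nbrs adj ?U x) \<le> 1 \<and> card (nbrs adj ?U y) \<le> 1" if "k = 2"
          using low[OF xy(1) vx] low[OF xy(2) wy] that by simp
      qed
      moreover have "nbrs adj ?U w = {y}"
        unfolding nbrs_del adjacent using adjacent \<open>w \<noteq> y\<close> by auto
      moreover have "nbrs adj (insert w ?U) v = {x, w}"
      proof -
        have "insert w ?U = U - {v}" using adjacent \<open>v \<noteq> w\<close> by auto
        then show ?thesis using adjacent(6) self[of v] by (simp add: nbrs_del)
      qed
      ultimately have "\<exists>P c. arc_coloring adj k (insert v (insert w ?U)) P c"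
        using extend_two_adjacent[OF _ UV _ _ _ _ \<open>v \<noteq> w\<close> adjacent(5,3)] adjacent(1,2) psubset.prems by blast
      moreover have "insert v (insert w ?U) = U" using adjacent by auto
      ultimately show ?thesis by simp
    qed
  qed
qed

end

section \<open>Incidence colorings from colorings of arcs\<close>

lemma incidence_coloring_of_arc_coloring:
  assumes graph: "finite_simple_graph V E" and col: "arc_coloring (\<lambda>u v. {u, v} \<in> E) k V P c"
  shows "incidence_coloring (k + 2) 2 V E (\<lambda>(u, e). c u (the_elem (e - {u})))"
proof -
  let ?adj = "\<lambda>u v. {u, v} \<in> E" and ?c = "\<lambda>(u, e). c u (the_elem (e - {u}))"
  have edge: "u \<in> V \<and> w \<in> V \<and> u \<noteq> w" if "{u, w} \<in> E" for u w
    using graph that by (fastforce simp: finite_simple_graph_def)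
  have read_off: "?c (u, {u, w}) = c u w" if "{u, w} \<in> E" for u w
  proof -
    have "{u, w} - {u} = {w}" using edge[OF that] by auto
    then show ?thesis by simp
  qed
  have P: "card (P v) = 2" "P v \<subseteq> {..<k + 2}" if "v \<in> V" for v
    using col that by (auto simp: arc_coloring_def)
  have inP: "c u w \<in> P w" "c u w \<notin> P u" if "{u, w} \<in> E" for u w
    using col edge[OF that] that by (auto simp: arc_coloring_def nbrs_def)
  have inj: "c u w \<noteq> c u w'" if "{u, w} \<in> E" "{u, w'} \<in> E" "w \<noteq> w'" for u w w'
  proof -
    have "w \<in> nbrs ?adj V u" "w' \<in> nbrs ?adj V u"
      using that edge[OF that(1)] edge[OF that(2)] by (simp_all add: nbrs_def)
    moreover have "inj_on (c u) (nbrs ?adj V u)"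
      using col edge[OF that(1)] by (simp add: arc_coloring_def)
    ultimately show ?thesis using that(3) by (auto dest: inj_onD)
  qed
  show ?thesis
    unfolding incidence_coloring_def
  proof (intro conjI ballI impI)
    have "?c ` incidences E \<subseteq> {..<k + 2}"
    proof (rule image_subsetI)
      fix i assume "i \<in> incidences E"
      then obtain u e where i: "i = (u, e)" and e: "e \<in> E" "u \<in> e" by (auto simp: incidences_def)
      then have "card e = 2" using graph by (simp add: finite_simple_graph_def)
      then obtain a b where "e = {a, b}" by (auto simp: card_2_iff)
      then obtain w where w: "e = {u, w}" using e(2) by blast
      have uw: "{u, w} \<in> E" using e(1) w by simp
      have "c u w \<in> {..<k + 2}" using inP(1)[OF uw] P(2)[of w] edge[OF uw] by blast
      then show "?c i \<in> {..<k + 2}" using read_off[OF uw] w i by simp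
    qed
    from card_mono[OF finite_lessThan this] show "card (?c ` incidences E) \<le> k + 2"
      by (simp only: card_lessThan)
  next
    fix i j assume inc: "i \<in> incidences E" "j \<in> incidences E" and "adjacent_incidences i j"
    then obtain v w v' w' where vw: "i = (v, {v, w})" "j = (v', {v', w'})" "i \<noteq> j"
      and cases: "v = v' \<or> w = v' \<or> v = w'"
      unfolding adjacent_incidences_def by blast
    have "{v, w} \<in> E" "{v', w'} \<in> E" using inc vw(1,2) by (simp_all add: incidences_def)
    note ij = vw this
    have "c v w \<noteq> c v' w'"
      using cases
    proof (elim disjE)
      assume "v = v'"
      then show ?thesis using ij inj[of v w w'] by auto
    next
      assume "w = v'"
      then show ?thesis using inP(1)[OF ij(4)] inP(2)[OF ij(5)] by metis
    next
      assume "v = w'"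
      then show ?thesis using inP(2)[OF ij(4)] inP(1)[OF ij(5)] by metis
    qed
    then show "?c i \<noteq> ?c j" using read_off[OF ij(4)] read_off[OF ij(5)] ij(1,2) by simp
  next
    fix v assume v: "v \<in> V"
    have "{?c (u, {u, v}) | u. {u, v} \<in> E} \<subseteq> P v"
      using read_off inP(1) by fastforce
    moreover have "finite (P v)" using P(1)[OF v] by (simp add: card_ge_0_finite)
    ultimately have "card {?c (u, {u, v}) | u. {u, v} \<in> E} \<le> card (P v)" by (intro card_mono)
    then show "card {?c (u, {u, v}) | u. {u, v} \<in> E} \<le> 2" by (simp only: P(1)[OF v])
  qed
qed

lemma card_nbrs_le_max_degree:
  assumes graph: "finite_simple_graph V E" and v: "v \<in> V"
  shows "card (nbrs (\<lambda>u v. {u, v} \<in> E) V v) \<le> max_degree V E"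
proof -
  have fin: "finite V" and "E \<subseteq> Pow V" using graph by (auto simp: finite_simple_graph_def)
  then have "finite E" using finite_subset by blast
  have "card (nbrs (\<lambda>u v. {u, v} \<in> E) V v) \<le> degree E v"
    unfolding degree_def
  proof (rule card_inj_on_le)
    show "inj_on (\<lambda>w. {v, w}) (nbrs (\<lambda>u v. {u, v} \<in> E) V v)"
      by (auto simp: inj_on_def doubleton_eq_iff)
  qed (use \<open>finite E\<close> in \<open>auto simp: nbrs_def\<close>)
  also have "degree E v \<le> max_degree V E"
    unfolding max_degree_def using v fin by (intro cSUP_upper) auto
  finally show ?thesis .
qed

section \<open>Graphs without thetas and crossing chords\<close>

text \<open>
  A single edge counts as a cycle, \<open>[u, w]\<close>. The longest cycle then exists as soon as there is an edge.
\<close>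

definition is_cycle :: "('a \<Rightarrow> 'a \<Rightarrow> bool) \<Rightarrow> 'a list \<Rightarrow> bool" where
  "is_cycle adj xs \<longleftrightarrow> xs \<noteq> [] \<and> distinct xs \<and> successively adj xs \<and> adj (last xs) (hd xs)"

text \<open>
  The excluded configurations are the subdivisions of \<open>K\<^sub>2\<^sub>,\<^sub>3\<close>.
\<close>

definition no_theta :: "('a \<Rightarrow> 'a \<Rightarrow> bool) \<Rightarrow> bool" where
  "no_theta adj \<longleftrightarrow> (\<forall>x y A B C. \<not> (distinct (x # A @ B @ C @ [y]) \<and> A \<noteq> [] \<and> B \<noteq> [] \<and> C \<noteq> [] \<and>
     successively adj (x # A @ [y]) \<and> successively adj (x # B @ [y]) \<and> successively adj (x # C @ [y])))"

text \<open>
  The ends of the two chords \<open>ab\<close> and \<open>ts\<close> alternate on the cycle, so that the cycle and the chords form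
  a subdivision of \<open>K\<^sub>4\<close>.
\<close>

definition no_crossing :: "('a \<Rightarrow> 'a \<Rightarrow> bool) \<Rightarrow> bool" where
  "no_crossing adj \<longleftrightarrow> (\<forall>a B t C b D s F.
     is_cycle adj (a # B @ t # C @ b # D @ s # F) \<longrightarrow> \<not> (adj a b \<and> adj t s))"

lemma is_cycle_rotate:
  assumes "is_cycle adj (A @ B)"
  shows "is_cycle adj (B @ A)"
  using assms by (cases "A = []"; cases "B = []") (auto simp: is_cycle_def successively_append_iff)

lemma is_cycle_start_at:
  assumes "is_cycle adj L" "x \<in> set L"
  obtains T where "is_cycle adj (x # T)" "set (x # T) = set L" "length (x # T) = length L"
proof -
  obtain A B where L: "L = A @ x # B" using assms(2) by (auto simp: in_set_conv_decomp)
  have "is_cycle adj ((x # B) @ A)" using assms(1) L is_cycle_rotate by metis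
  then show ?thesis using that[of "B @ A"] L by auto
qed

lemma nth_split_four:
  assumes "i < j" "j < k" "k < l" "l < length L"
  obtains P B C D F where "L = P @ L ! i # B @ L ! j # C @ L ! k # D @ L ! l # F"
proof -
  have step: "\<exists>M. drop (Suc u) L = M @ L ! v # drop (Suc v) L" if "u < v" "v < length L" for u v
  proof -
    have "v - Suc u < length (drop (Suc u) L)" using that by simp
    from id_take_nth_drop[OF this] show ?thesis using that by (intro exI) (simp add: Suc_diff_Suc)
  qed
  have "L = take i L @ L ! i # drop (Suc i) L" using assms by (intro id_take_nth_drop) simp
  moreover obtain B where "drop (Suc i) L = B @ L ! j # drop (Suc j) L" using step[of i j] assms by auto
  moreover obtain C where "drop (Suc j) L = C @ L ! k # drop (Suc k) L" using step[of j k] assms by auto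
  moreover obtain D where "drop (Suc k) L = D @ L ! l # drop (Suc l) L" using step[of k l] assms by auto
  ultimately have "L = take i L @ L ! i # B @ L ! j # C @ L ! k # D @ L ! l # drop (Suc l) L" by metis
  then show ?thesis by (rule that)
qed

text \<open>
  The crossing chords may start anywhere in the list, because a cycle can be rotated until the first of
  their four ends comes first.
\<close>

lemma no_crossing_nth:
  assumes nc: "no_crossing adj" and cyc: "is_cycle adj L" and ord: "i < j" "j < k" "k < l" "l < length L"
    and e: "adj (L ! i) (L ! k)" "adj (L ! j) (L ! l)"
  shows False
proof -
  obtain P B C D F where L: "L = P @ L ! i # B @ L ! j # C @ L ! k # D @ L ! l # F"
    using nth_split_four[OF ord] .
  have "is_cycle adj (N @ M)" if "L = M @ N" for M N
    using cyc that is_cycle_rotate by simp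
  from this[OF L] have "is_cycle adj ((L ! i # B @ L ! j # C @ L ! k # D @ L ! l # F) @ P)" .
  then have "is_cycle adj (L ! i # B @ L ! j # C @ L ! k # D @ L ! l # (F @ P))" by simp
  then show False using nc e unfolding no_crossing_def by blast
qed

text \<open>
  The set \<open>S\<close> is joined to the rest of the graph only through \<open>r\<close>. If \<open>S\<close> is minimal with this property,
  then \<open>S \<union> {r}\<close> has the role of a leaf block with the cut vertex \<open>r\<close>.
\<close>

definition hangs_on :: "('a \<Rightarrow> 'a \<Rightarrow> bool) \<Rightarrow> 'a set \<Rightarrow> 'a set \<Rightarrow> 'a \<Rightarrow> bool" where
  "hangs_on adj U S r \<longleftrightarrow> S \<noteq> {} \<and> S \<subseteq> U \<and> r \<in> U - S \<and> (\<forall>u\<in>S. nbrs adj U u \<subseteq> insert r S)"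

context
  fixes adj :: "'a \<Rightarrow> 'a \<Rightarrow> bool"
  assumes sym: "adj u v \<Longrightarrow> adj v u" and irrefl: "\<not> adj u u"
begin

lemma successively_rev_adj: "successively adj (rev xs) \<longleftrightarrow> successively adj xs"
proof -
  have "(\<lambda>u v. adj v u) = adj" using sym by (intro ext) blast
  then show ?thesis unfolding successively_rev by (rule arg_cong)
qed

text \<open>
  If the ends \<open>x\<close> and \<open>y\<close> of the ear \<open>xs\<close> are neighbours on the cycle, the ear can replace the edge
  between them. Otherwise the ear and the two parts of the cycle are three paths from \<open>x\<close> to \<open>y\<close>.
\<close>

lemma ear_lengthens_cycle:
  assumes nt: "no_theta adj" and cyc: "is_cycle adj (x # A @ y # B)"
    and ear: "xs \<noteq> []" "distinct xs" "successively adj xs" "set xs \<inter> set (x # A @ y # B) = {}"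
      "adj x (hd xs)" "adj (last xs) y"
  obtains C where "is_cycle adj C" "set C \<subseteq> set (x # A @ y # B) \<union> set xs" "length (x # A @ y # B) < length C"
proof (cases "A = [] \<or> B = []")
  case True
  then show ?thesis
  proof
    assume [simp]: "A = []"
    have "is_cycle adj (x # xs @ y # B)"
      using cyc ear by (auto simp: is_cycle_def successively_append_iff successively_Cons split: if_splits)
    then show ?thesis by (rule that) (use ear in auto)
  next
    assume [simp]: "B = []"
    have "successively adj (rev xs)" using ear(3) by (simp only: successively_rev_adj)
    moreover have "hd (A @ y # rev xs) = hd (A @ [y])" by (cases A) simp_all
    moreover have "adj (hd xs) x" "adj y (last xs)" using ear(5,6) sym by blast+
    ultimately have "is_cycle adj (x # A @ y # rev xs)"
      using cyc ear(1-4)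
      by (auto simp: is_cycle_def successively_append_iff successively_Cons hd_rev last_rev split: if_splits)
    then show ?thesis by (rule that) (use ear in auto)
  qed
next
  case False
  have "successively adj ((x # A) @ y # B)" "adj (last (y # B)) x" using cyc by (simp_all add: is_cycle_def)
  then have "successively adj (x # A @ [y])" "successively adj (y # B @ [x])"
    unfolding append_Cons[symmetric] successively_append_iff by (simp_all add: successively_Cons)
  moreover from this(2) have "successively adj (rev (y # B @ [x]))" by (simp only: successively_rev_adj)
  then have "successively adj (x # rev B @ [y])" by simp
  moreover have "successively adj (x # xs @ [y])"
    using ear by (auto simp: successively_append_iff successively_Cons)
  moreover have "distinct (x # A @ rev B @ xs @ [y])" using cyc ear by (auto simp: is_cycle_def)
  moreover have "rev B \<noteq> []" using False by simp
  ultimately have False using nt False ear(1) unfolding no_theta_def by blast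
  then show ?thesis ..
qed

text \<open>
  The part of \<open>S \<union> {r}\<close> that can be reached from \<open>s\<close> outside the cycle has a neighbour on the cycle other
  than \<open>x\<close>. If it had not, then \<open>x\<close> would separate it from the rest of the cycle, and whichever of
  the two sides does not contain \<open>r\<close> would hang on \<open>x\<close> and be smaller than \<open>S\<close>.
\<close>

lemma path_leaves_around_cut_vertex:
  assumes SU: "hangs_on adj U S r"
    and minimal: "\<And>S' r'. S' \<subset> S \<Longrightarrow> \<not> hangs_on adj U S' r'"
    and cyc: "is_cycle adj C" and CH: "set C \<subseteq> insert r S" and x: "x \<in> set C"
    and s: "s \<in> insert r S - set C"
  obtains xs y where "xs \<noteq> []" "hd xs = s" "distinct xs" "successively adj xs"
    "set xs \<subseteq> insert r S - set C" "y \<in> set C" "y \<noteq> x" "adj (last xs) y"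
proof -
  define W where "W = insert r S - set C"
  define K where "K = {z. \<exists>xs. xs \<noteq> [] \<and> hd xs = s \<and> last xs = z \<and> distinct xs \<and> successively adj xs \<and> set xs \<subseteq> W}"
  have sK: "s \<in> K" unfolding K_def using s by (intro CollectI exI[of _ "[s]"]) (auto simp: W_def)
  have KW: "K \<subseteq> W" unfolding K_def using last_in_set by blast
  have closed: "z' \<in> K" if z: "z \<in> K" "z' \<in> W" "adj z z'" for z z'
  proof -
    obtain xs where xs: "xs \<noteq> []" "hd xs = s" "last xs = z" "distinct xs" "successively adj xs" "set xs \<subseteq> W"
      using z(1) unfolding K_def by blast
    show ?thesis
    proof (cases "z' \<in> set xs")
      case True
      then obtain as bs where ab: "xs = (as @ [z']) @ bs" by (metis append.assoc append_Cons append_Nil in_set_conv_decomp)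
      then have "hd (as @ [z']) = s" using xs(2) by (cases as) auto
      then show ?thesis unfolding K_def using xs ab
        by (intro CollectI exI[of _ "as @ [z']"]) (auto simp: successively_append_iff)
    next
      case False
      then show ?thesis unfolding K_def using xs z
        by (intro CollectI exI[of _ "xs @ [z']"]) (auto simp: successively_append_iff)
    qed
  qed
  have "\<exists>x'\<in>set C. x' \<noteq> x"
  proof -
    have "last C \<noteq> hd C" using cyc irrefl unfolding is_cycle_def by metis
    moreover have "last C \<in> set C" "hd C \<in> set C" using cyc by (auto simp: is_cycle_def)
    ultimately show ?thesis by metis
  qed
  then obtain x' where x': "x' \<in> set C" "x' \<noteq> x" by blast
  have "\<exists>z\<in>K. \<exists>y\<in>set C. y \<noteq> x \<and> adj z y"
  proof (rule ccontr)
    assume neg: "\<not> ?thesis"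
    have U: "insert r S \<subseteq> U" "r \<notin> S" and nb: "\<And>u. u \<in> S \<Longrightarrow> nbrs adj U u \<subseteq> insert r S"
      using SU by (auto simp: hangs_on_def)
    show False
    proof (cases "r \<in> K")
      case False
      have "K \<subseteq> S" using False KW by (auto simp: W_def)
      moreover have "hangs_on adj U K x"
        unfolding hangs_on_def
      proof (intro conjI ballI subsetI)
        fix u w assume u: "u \<in> K" and w: "w \<in> nbrs adj U u"
        then have "w \<in> insert r S" using nb \<open>K \<subseteq> S\<close> by blast
        moreover have "adj u w" using w by (simp add: nbrs_def)
        ultimately show "w \<in> insert x K" using closed[OF u, of w] neg u by (auto simp: W_def)
      qed (use sK \<open>K \<subseteq> S\<close> U x CH KW in \<open>auto simp: W_def\<close>)
      moreover have "K \<noteq> S" using x x' CH KW by (auto simp: W_def)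
      ultimately show False using minimal by blast
    next
      case True
      define S' where "S' = insert r S - K - {x}"
      have "S' \<subseteq> S" using True by (auto simp: S'_def)
      moreover have "x \<in> S" using True x CH KW by (auto simp: W_def)
      moreover have "hangs_on adj U S' x"
        unfolding hangs_on_def
      proof (intro conjI ballI subsetI)
        fix u w assume u: "u \<in> S'" and w: "w \<in> nbrs adj U u"
        then have wH: "w \<in> insert r S" using nb \<open>S' \<subseteq> S\<close> by blast
        have "adj w u" using w sym unfolding nbrs_def by blast
        then have "w \<notin> K" using closed[of w u] neg u by (auto simp: S'_def W_def)
        then show "w \<in> insert x S'" using wH by (auto simp: S'_def)
      qed (use U x x' CH KW in \<open>auto simp: W_def S'_def\<close>)
      ultimately show False using minimal[of S' x] by (auto simp: S'_def)
    qed
  qed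
  then obtain z y where "z \<in> K" "y \<in> set C" "y \<noteq> x" "adj z y" by blast
  then show ?thesis using that unfolding K_def W_def by blast
qed

text \<open>
  If a longest cycle missed a vertex \<open>s\<close>, a path from \<open>s\<close> would reach the cycle at some \<open>x\<close>. A second
  path, from the last vertex before \<open>x\<close>, reaches it at some \<open>y \<noteq> x\<close>, and this gives an ear.
\<close>

lemma spanning_cycle_of_minimal_hanging_set:
  assumes nt: "no_theta adj" and fin: "finite U" and SU: "hangs_on adj U S r"
    and minimal: "\<And>S' r'. S' \<subset> S \<Longrightarrow> \<not> hangs_on adj U S' r'"
    and edge: "\<And>v. v \<in> U \<Longrightarrow> nbrs adj U v \<noteq> {}"
  obtains T where "is_cycle adj (r # T)" "set T = S"
proof -
  let ?cyc = "\<lambda>C. is_cycle adj C \<and> set C \<subseteq> insert r S"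
  have finH: "finite (insert r S)" using SU fin finite_subset by (auto simp: hangs_on_def)
  obtain u where u: "u \<in> S" using SU by (auto simp: hangs_on_def)
  then have "u \<in> U" using SU by (auto simp: hangs_on_def)
  then obtain w where w: "w \<in> nbrs adj U u" using edge by blast
  have "?cyc [u, w]" using u w SU sym irrefl by (auto simp: is_cycle_def nbrs_def hangs_on_def)
  moreover have "\<forall>C. ?cyc C \<longrightarrow> length C < Suc (card (insert r S))"
    using finH by (metis card_mono distinct_card is_cycle_def less_Suc_eq_le)
  ultimately obtain C where C: "?cyc C" and longest: "\<And>C'. ?cyc C' \<Longrightarrow> length C' \<le> length C"
    using ex_has_greatest_nat[of ?cyc _ length] by metis
  have "set C = insert r S"
  proof (rule ccontr)
    assume "set C \<noteq> insert r S"
    then obtain s where s: "s \<in> insert r S - set C" using C by blast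
    have "hd C \<in> set C" using C by (auto simp: is_cycle_def)
    from path_leaves_around_cut_vertex[OF SU minimal conjunct1[OF C] conjunct2[OF C] this s]
    obtain xs x where xs: "xs \<noteq> []" "set xs \<subseteq> insert r S - set C" "x \<in> set C" "adj (last xs) x" by metis
    then have z: "last xs \<in> insert r S - set C" using last_in_set by blast
    from path_leaves_around_cut_vertex[OF SU minimal conjunct1[OF C] conjunct2[OF C] xs(3) z]
    obtain ys y where ys: "ys \<noteq> []" "hd ys = last xs" "distinct ys" "successively adj ys"
      "set ys \<subseteq> insert r S - set C" "y \<in> set C" "y \<noteq> x" "adj (last ys) y" by metis
    obtain T where T: "is_cycle adj (x # T)" "set (x # T) = set C" "length (x # T) = length C"
      using is_cycle_start_at[of adj C x] C xs(3) by metis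
    then have "y \<in> set T" using ys by auto
    then obtain A B where AB: "T = A @ y # B" by (auto simp: in_set_conv_decomp)
    have TH: "set (x # A @ y # B) \<subseteq> insert r S" using T(2) C by (simp only: AB)
    have "set ys \<inter> set (x # A @ y # B) = {}" using ys(5) T(2) unfolding AB by blast
    moreover have "adj x (hd ys)" unfolding ys(2) using xs(4) by (rule sym)
    ultimately obtain C' where C': "is_cycle adj C'" "set C' \<subseteq> set (x # A @ y # B) \<union> set ys"
      "length (x # A @ y # B) < length C'"
      by (rule ear_lengthens_cycle[OF nt T(1)[unfolded AB] ys(1,3,4) _ _ ys(8)])
    have "set C' \<subseteq> insert r S" using C'(2) TH ys(5) by blast
    then have "length C' \<le> length C" using longest C'(1) by blast
    then show False using C'(3) T(3) by (simp only: AB)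
  qed
  moreover from this have "r \<in> set C" by simp
  from is_cycle_start_at[OF conjunct1[OF C] this]
  obtain T where T: "is_cycle adj (r # T)" "set (r # T) = set C" "length (r # T) = length C" .
  moreover have "r \<notin> set T" "r \<notin> S" using T(1) SU by (simp_all add: is_cycle_def hangs_on_def)
  ultimately have "set T = S" by auto
  then show ?thesis using that T(1) by blast
qed

text \<open>
  Number the vertices \<open>L ! 0 = r, L ! 1, \<dots>\<close> of the spanning cycle of a minimal hanging set. All
  neighbours of the vertices with positive index are on the cycle. Among the edges between vertices whose
  indices differ by at least 2, which include the closing edge of the cycle, take one with the least
  difference. The vertices between its ends have only their two neighbours on the cycle.
\<close>

lemma reducible_if_no_theta_no_crossing:
  assumes nt: "no_theta adj" and nc: "no_crossing adj" and fin: "finite U" and ne: "U \<noteq> {}"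
  shows "reducible adj U"
proof (cases "\<exists>v\<in>U. card (nbrs adj U v) \<le> 1")
  case True
  then show ?thesis by (simp add: reducible_def)
next
  case False
  have edge: "nbrs adj U v \<noteq> {}" if "v \<in> U" for v using False that by force
  obtain v where v: "v \<in> U" using ne by blast
  then obtain w where "w \<in> U" "w \<noteq> v" using edge[OF v] irrefl by (auto simp: nbrs_def)
  then have "hangs_on adj U (U - {v}) v" using v by (auto simp: hangs_on_def nbrs_def)
  then obtain S where S: "\<exists>r. hangs_on adj U S r" and least: "\<And>S'. \<exists>r. hangs_on adj U S' r \<Longrightarrow> card S \<le> card S'"
    using ex_has_least_nat[of "\<lambda>S. \<exists>r. hangs_on adj U S r" _ card] by blast
  then obtain r where SU: "hangs_on adj U S r" by blast
  have finS: "finite S" using SU fin finite_subset by (auto simp: hangs_on_def)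
  have minimal: "\<not> hangs_on adj U S' r'" if "S' \<subset> S" for S' r'
    using least[of S'] psubset_card_mono[OF finS that] by auto
  obtain T where cyc: "is_cycle adj (r # T)" and T: "set T = S"
    using spanning_cycle_of_minimal_hanging_set[OF nt fin SU minimal edge] by blast
  define L where "L = r # T"
  note cyc = cyc[folded L_def]
  have dist: "distinct L" using cyc by (simp add: is_cycle_def)
  have succ: "adj (L ! i) (L ! Suc i)" if "Suc i < length L" for i
    using cyc that by (simp add: is_cycle_def successively_conv_nth)
  have nbL: "nbrs adj U (L ! t) \<subseteq> set L" if "0 < t" "t < length L" for t
  proof -
    have "L ! t \<in> S" using that T by (auto simp: L_def nth_Cons')
    then show ?thesis using SU T by (simp add: L_def hangs_on_def)
  qed
  have LU: "set L \<subseteq> U" using SU T by (auto simp: L_def hangs_on_def)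
  have len: "3 \<le> length L"
  proof -
    obtain u where u: "u \<in> S" using SU by (auto simp: hangs_on_def)
    then have "u \<in> U" "nbrs adj U u \<subseteq> insert r S" using SU by (auto simp: hangs_on_def)
    moreover have "u \<notin> nbrs adj U u" using irrefl by (simp add: nbrs_def)
    moreover have "set L = insert r S" using T by (simp add: L_def)
    ultimately have "nbrs adj U u \<subseteq> set L - {u}" by blast
    then have "card (nbrs adj U u) \<le> card (set L - {u})" by (intro card_mono) simp_all
    moreover have "\<not> card (nbrs adj U u) \<le> 1" using False \<open>u \<in> U\<close> by blast
    ultimately have "2 \<le> card (set L - {u})" by linarith
    moreover have "u \<in> set L" using u T by (simp add: L_def)
    ultimately show ?thesis using distinct_card[OF dist] by simp
  qed
  \<comment> \<open>the closing edge of the cycle satisfies this for \<open>(0, length L - 1)\<close>, since the cycle has at least three vertices\<close>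
  let ?chord = "\<lambda>(a, b). a + 2 \<le> b \<and> b < length L \<and> adj (L ! a) (L ! b)"
  have "adj (hd L) (last L)" using cyc sym by (simp add: is_cycle_def)
  then have "?chord (0, length L - 1)"
    using cyc len by (simp add: is_cycle_def last_conv_nth hd_conv_nth)
  from ex_has_least_nat[of ?chord, OF this, of "\<lambda>q. snd q - fst q"]
  obtain a b where chord: "a + 2 \<le> b" "b < length L" "adj (L ! a) (L ! b)"
    and short: "\<And>q. ?chord q \<Longrightarrow> b - a \<le> snd q - fst q"
    by auto
  have inner: "nbrs adj U (L ! t) = {L ! (t - 1), L ! Suc t}" if t: "a < t" "t < b" for t
  proof
    have "adj (L ! t) (L ! (t - 1))" "adj (L ! t) (L ! Suc t)"
      using t chord sym[OF succ[of "t - 1"]] succ[of t] by simp_all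
    moreover have "L ! (t - 1) \<in> U" "L ! Suc t \<in> U"
      using t chord LU nth_mem[of "t - 1" L] nth_mem[of "Suc t" L] by (simp_all add: subset_iff)
    ultimately show "{L ! (t - 1), L ! Suc t} \<subseteq> nbrs adj U (L ! t)"
      by (simp add: nbrs_def)
    show "nbrs adj U (L ! t) \<subseteq> {L ! (t - 1), L ! Suc t}"
    proof
      fix w assume w: "w \<in> nbrs adj U (L ! t)"
      then obtain s where s: "w = L ! s" "s < length L"
        using nbL[of t] t chord by (auto simp: in_set_conv_nth subset_iff)
      have "adj (L ! t) (L ! s)" using w s by (simp add: nbrs_def)
      note adj = this sym[OF this]
      have "s \<noteq> t" using adj irrefl by metis
      have "\<not> s < a" using no_crossing_nth[OF nc cyc, of s a t b] t chord adj by auto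
      moreover have "\<not> b < s" using no_crossing_nth[OF nc cyc, of a t b s] t chord adj s by auto
      moreover have "\<not> s + 2 \<le> t" using short[of "(s, t)"] adj t chord \<open>\<not> s < a\<close> by auto
      moreover have "\<not> t + 2 \<le> s" using short[of "(t, s)"] adj t s chord \<open>\<not> b < s\<close> by auto
      ultimately have "s = t - 1 \<or> s = Suc t" using \<open>s \<noteq> t\<close> by linarith
      then show "w \<in> {L ! (t - 1), L ! Suc t}" using s by auto
    qed
  qed
  have mem: "L ! i \<in> U" if "i \<le> b" for i
    using that chord(2) LU nth_mem[of i L] by auto
  show ?thesis
  proof (cases "b = a + 2")
    case True
    then have "nbrs adj U (L ! Suc a) = {L ! a, L ! b}" using inner[of "Suc a"] by simp
    moreover have "L ! Suc a \<in> U" using mem True by simp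
    ultimately show ?thesis unfolding reducible_def using chord(3) by blast
  next
    case False
    then have "nbrs adj U (L ! (a+1)) = {L ! a, L ! (a+2)}" "nbrs adj U (L ! (a+2)) = {L ! (a+1), L ! (a+3)}"
      using inner[of "a+1"] inner[of "a+2"] chord by (simp_all add: numeral_3_eq_3)
    moreover have "L ! a \<noteq> L ! (a+2)" "L ! (a+1) \<noteq> L ! (a+3)"
      using chord False dist by (simp_all add: nth_eq_iff_index_eq)
    moreover have "L ! (a+1) \<in> U" "L ! (a+2) \<in> U" using mem chord by simp_all
    ultimately show ?thesis unfolding reducible_def by blast
  qed
qed

end

section \<open>Theta curves in the plane\<close>

definition theta :: "complex \<Rightarrow> complex \<Rightarrow> (real \<Rightarrow> complex) \<Rightarrow> (real \<Rightarrow> complex) \<Rightarrow> (real \<Rightarrow> complex) \<Rightarrow> bool" where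
  "theta a b c1 c2 c3 \<longleftrightarrow>
     (\<forall>c\<in>{c1,c2,c3}. arc c \<and> pathstart c = a \<and> pathfinish c = b) \<and>
     path_image c1 \<inter> path_image c2 = {a,b} \<and> path_image c1 \<inter> path_image c3 = {a,b} \<and>
     path_image c2 \<inter> path_image c3 = {a,b}"

lemma theta_arcs:
  assumes "theta a b c1 c2 c3"
  shows "arc c1" "pathstart c1 = a" "pathfinish c1 = b" "arc c2" "pathstart c2 = a" "pathfinish c2 = b"
    "arc c3" "pathstart c3 = a" "pathfinish c3 = b"
    "path_image c1 \<inter> path_image c2 = {a,b}" "path_image c1 \<inter> path_image c3 = {a,b}"
    "path_image c2 \<inter> path_image c3 = {a,b}"
  using assms by (auto simp: theta_def)

lemma theta_swap:
  assumes "theta a b c1 c2 c3"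
  shows "theta a b c2 c1 c3" "theta a b c1 c3 c2"
  using assms by (auto simp: theta_def Int_commute)

lemma theta_Jordan:
  assumes "theta a b c1 c2 c3"
  defines "J \<equiv> path_image c1 \<union> path_image c2"
  shows "inside J \<noteq> {}" "open (inside J)" "connected (inside J)" "connected (outside J)"
    "frontier (inside J) = J"
proof -
  have sp: "simple_path (c1 +++ reversepath c2)"
    using theta_arcs[OF assms(1)] by (intro simple_path_join_loop arc_reversepath) auto
  have im: "path_image (c1 +++ reversepath c2) = J"
    using theta_arcs[OF assms(1)] by (simp add: path_image_join J_def)
  have cl: "pathfinish (c1 +++ reversepath c2) = pathstart (c1 +++ reversepath c2)"
    using theta_arcs[OF assms(1)] by simp
  show "inside J \<noteq> {}" "open (inside J)" "connected (inside J)" "connected (outside J)"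
    "frontier (inside J) = J"
    using Jordan_inside_outside[OF sp cl] unfolding im by auto
qed

text \<open>
  A point \<open>y\<close> outside both closed curves that contain \<open>c3\<close> is separated from infinity by neither of them.
  They meet in the connected set \<open>c3\<close>, so by Janiszewski's theorem their union does not separate \<open>y\<close> from
  infinity either. But this union contains the closed curve formed by \<open>c1\<close> and \<open>c2\<close>.
\<close>

lemma theta_inside_cover:
  assumes th: "theta a b c1 c2 c3"
  shows "inside (path_image c1 \<union> path_image c2) - path_image c3
    \<subseteq> inside (path_image c1 \<union> path_image c3) \<union> inside (path_image c2 \<union> path_image c3)"
proof
  let ?A = "path_image c1" and ?B = "path_image c2" and ?C = "path_image c3"
  let ?T = "?A \<union> ?B \<union> ?C"
  fix y assume y: "y \<in> inside (?A \<union> ?B) - ?C"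
  show "y \<in> inside (?A \<union> ?C) \<union> inside (?B \<union> ?C)"
  proof (rule ccontr)
    assume n: "y \<notin> inside (?A \<union> ?C) \<union> inside (?B \<union> ?C)"
    have yn: "y \<notin> ?A \<union> ?B" using y inside_no_overlap by blast
    have o: "y \<in> outside (?A \<union> ?C)" "y \<in> outside (?B \<union> ?C)"
      using n yn y by (auto simp: outside_inside)
    have cp: "compact ?A" "compact ?B" "compact ?C"
      using theta_arcs[OF th] by (simp_all add: compact_arc_image)
    have "\<not> bounded (outside ?T)"
      using cp by (intro unbounded_outside compact_imp_bounded compact_Un)
    then obtain z where z: "z \<in> outside ?T" by fastforce
    have z12: "z \<in> outside (?A \<union> ?B)" "z \<in> outside (?A \<union> ?C)" "z \<in> outside (?B \<union> ?C)"
      using z outside_mono[of "?A \<union> ?B" ?T] outside_mono[of "?A \<union> ?C" ?T]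
       outside_mono[of "?B \<union> ?C" ?T] by blast+
    have sub: "outside (?A \<union> ?C) \<subseteq> - (?A \<union> ?C)" "outside (?B \<union> ?C) \<subseteq> - (?B \<union> ?C)"
      using outside_no_overlap by blast+
    have conn: "connected (outside (?A \<union> ?C))" "connected (outside (?B \<union> ?C))"
      using theta_Jordan(4)[OF theta_swap(2)[OF th]]
        theta_Jordan(4)[OF theta_swap(2)[OF theta_swap(1)[OF th]]] by auto
    have cc: "connected_component (- (?A \<union> ?C)) y z"
      using connected_componentI[OF conn(1) sub(1) o(1) z12(2)] .
    have cc': "connected_component (- (?B \<union> ?C)) y z"
      using connected_componentI[OF conn(2) sub(2) o(2) z12(3)] .
    have "{a,b} \<subseteq> ?C" using theta_arcs(11)[OF th] by blast
    then have "(?A \<union> ?C) \<inter> (?B \<union> ?C) = ?C" using theta_arcs(10)[OF th] by blast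
    then have "connected ((?A \<union> ?C) \<inter> (?B \<union> ?C))"
      using theta_arcs(7)[OF th] by (simp add: connected_arc_image)
    from Janiszewski[OF _ _ this cc cc']
    have "connected_component (- (?A \<union> ?C \<union> (?B \<union> ?C))) y z"
      using cp by (simp add: compact_Un compact_imp_closed closed_Un)
    then have "connected_component (- (?A \<union> ?B)) y z"
      by (rule connected_component_of_subset) blast
    then have "y \<in> outside (?A \<union> ?B)"
      using z12(1) outside_same_component by (metis connected_component_sym)
    then show False using y inside_Int_outside by blast
  qed
qed

text \<open>
  By the hypotheses on \<open>c2\<close> and \<open>c3\<close>, both insides are disjoint from the whole theta curve. As they are
  connected, each would contain the other if they met. They would be equal and have the same frontier, so
  that \<open>c2\<close> would lie on \<open>c1\<close> and \<open>c3\<close> and have no points besides its ends.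
\<close>

lemma theta_insides_disjoint:
  assumes th: "theta a b c1 c2 c3"
    and out: "path_image c3 \<inter> inside (path_image c1 \<union> path_image c2) = {}"
      "path_image c2 \<inter> inside (path_image c1 \<union> path_image c3) = {}"
  shows "inside (path_image c1 \<union> path_image c2) \<inter> inside (path_image c1 \<union> path_image c3) = {}"
proof (rule ccontr)
  let ?A = "path_image c1" and ?B = "path_image c2" and ?C = "path_image c3"
  assume ne: "inside (?A \<union> ?B) \<inter> inside (?A \<union> ?C) \<noteq> {}"
  note AB = theta_Jordan[OF th] and AC = theta_Jordan[OF theta_swap(2)[OF th]]
  have "inside (?A \<union> ?C) \<inter> inside (?A \<union> ?B) \<noteq> {}" "(?A \<union> ?C) \<inter> inside (?A \<union> ?B) = {}"
    using ne out(1) inside_no_overlap[of "?A \<union> ?B"] by blast+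
  then have "outside (?A \<union> ?C) \<inter> inside (?A \<union> ?B) = {}"
    using inside_outside_intersect_connected[OF AB(3)] by blast
  then have sub: "inside (?A \<union> ?B) \<subseteq> inside (?A \<union> ?C)"
    using \<open>(?A \<union> ?C) \<inter> inside (?A \<union> ?B) = {}\<close> inside_Un_outside[of "?A \<union> ?C"] by blast
  have "(?A \<union> ?B) \<inter> inside (?A \<union> ?C) = {}"
    using out(2) inside_no_overlap[of "?A \<union> ?C"] by blast
  then have "outside (?A \<union> ?B) \<inter> inside (?A \<union> ?C) = {}"
    using inside_outside_intersect_connected[OF AC(3) ne] by blast
  then have "inside (?A \<union> ?C) \<subseteq> inside (?A \<union> ?B)"
    using \<open>(?A \<union> ?B) \<inter> inside (?A \<union> ?C) = {}\<close> inside_Un_outside[of "?A \<union> ?B"] by blast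
  with sub have "inside (?A \<union> ?C) = inside (?A \<union> ?B)" by blast
  with AB(5) AC(5) have "?A \<union> ?B = ?A \<union> ?C" by metis
  then have "?B - {a,b} = {}" using theta_arcs(10,12)[OF th] by blast
  then show False
    using nonempty_simple_path_endless[OF arc_imp_simple_path[OF theta_arcs(4)[OF th]]]
      theta_arcs(5,6)[OF th] by simp
qed

text \<open>
  Without its ends the arc is connected and does not meet the closed curve, so that one of its points
  decides for all of them.
\<close>

lemma theta_arc_not_inside:
  assumes th: "theta a b c1 c2 c3"
    and t: "t \<in> path_image c1 - {a,b}" "t \<notin> inside (path_image c2 \<union> path_image c3)"
  shows "path_image c1 \<inter> inside (path_image c2 \<union> path_image c3) = {}"
proof (rule ccontr)
  let ?A = "path_image c1" and ?B = "path_image c2" and ?C = "path_image c3"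
  assume "\<not> ?thesis"
  then have ne: "inside (?B \<union> ?C) \<inter> (?A - {a,b}) \<noteq> {}"
    using inside_no_overlap[of "?B \<union> ?C"] theta_arcs(12)[OF th] by blast
  have "connected (?A - {a,b})"
    using connected_simple_path_endless[OF arc_imp_simple_path[OF theta_arcs(1)[OF th]]]
      theta_arcs(2,3)[OF th] by simp
  from inside_outside_intersect_connected[OF this ne] have "t \<notin> outside (?B \<union> ?C)"
    using t theta_arcs(10,11)[OF th] by blast
  moreover have "t \<notin> ?B \<union> ?C" using t theta_arcs(10,11)[OF th] by blast
  ultimately show False using t(2) inside_outside by blast
qed

text \<open>
  If no arc passed through the inside of the closed curve formed by the other two, the three insides would
  be pairwise disjoint by \<open>theta_insides_disjoint\<close>. By \<open>theta_inside_cover\<close> the first is covered by the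
  other two, so it would be empty. The points \<open>t1\<close> and \<open>t2\<close> exclude \<open>c1\<close> and \<open>c2\<close>, and \<open>c3\<close> remains.
\<close>

lemma theta_arc_inside:
  assumes th: "theta a b c1 c2 c3"
    and t1: "t1 \<in> path_image c1 - {a,b}" "t1 \<notin> inside (path_image c2 \<union> path_image c3)"
    and t2: "t2 \<in> path_image c2 - {a,b}" "t2 \<notin> inside (path_image c1 \<union> path_image c3)"
  shows "path_image c3 \<inter> inside (path_image c1 \<union> path_image c2) \<noteq> {}"
proof
  let ?A = "path_image c1" and ?B = "path_image c2" and ?C = "path_image c3"
  assume C: "?C \<inter> inside (?A \<union> ?B) = {}"
  have A: "?A \<inter> inside (?B \<union> ?C) = {}"
    by (rule theta_arc_not_inside[OF th t1])
  have B: "?B \<inter> inside (?A \<union> ?C) = {}"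
    by (rule theta_arc_not_inside[OF theta_swap(1)[OF th] t2])
  have "inside (?A \<union> ?B) \<subseteq> inside (?A \<union> ?C) \<union> inside (?B \<union> ?C)"
    using theta_inside_cover[OF th] C by blast
  moreover have "inside (?A \<union> ?B) \<inter> inside (?A \<union> ?C) = {}"
    by (rule theta_insides_disjoint[OF th C B])
  moreover have "inside (?A \<union> ?B) \<inter> inside (?B \<union> ?C) = {}"
    using theta_insides_disjoint[OF theta_swap(1)[OF th]] A C unfolding Un_commute[of ?B ?A] by blast
  ultimately have "inside (?A \<union> ?B) = {}" by blast
  then show False using theta_Jordan(1)[OF th] by simp
qed

lemma end_in_closure_endless:
  fixes e :: "real \<Rightarrow> complex"
  assumes "path e" "e ` {0<..<1} \<subseteq> T"
  shows "pathstart e \<in> closure T" "pathfinish e \<in> closure T"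
proof -
  have "e ` closure {0<..<1} \<subseteq> closure T"
    by (rule image_closure_subset) (use assms closure_subset in \<open>auto simp: path_def\<close>)
  then show "pathstart e \<in> closure T" "pathfinish e \<in> closure T"
    by (auto simp: pathstart_def pathfinish_def)
qed

text \<open>
  The chord \<open>c\<close> divides the inside of the closed curve into two parts, and without its ends the chord \<open>e\<close>
  is connected. If it avoids \<open>c\<close>, it lies in one part, and its two ends are in the closure of that part.
  But one end of \<open>e\<close> is on \<open>c1\<close>, the other on \<open>c2\<close>, and only one of them can be in this closure.
\<close>

lemma chords_inside_cross:
  assumes th: "theta a b c1 c2 c" and arce: "arc e"
    and cin: "path_image c \<inter> inside (path_image c1 \<union> path_image c2) \<noteq> {}"
    and e: "pathstart e \<in> path_image c1 - {a,b}" "pathfinish e \<in> path_image c2 - {a,b}"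
    and ec: "path_image e \<inter> (path_image c1 \<union> path_image c2) \<subseteq> {pathstart e, pathfinish e}"
    and ein: "path_image e \<inter> inside (path_image c1 \<union> path_image c2) \<noteq> {}"
    and out: "pathstart e \<notin> inside (path_image c2 \<union> path_image c)" "pathfinish e \<notin> inside (path_image c1 \<union> path_image c)"
  shows "path_image e \<inter> path_image c \<noteq> {}"
proof
  let ?A = "path_image c1" and ?B = "path_image c2" and ?C = "path_image c"
  let ?e = "e ` {0<..<1}"
  assume dis: "path_image e \<inter> ?C = {}"
  note arcs = theta_arcs[OF th]
  have "a \<noteq> b" using arcs(1-3) by (metis arc_distinct_ends)
  note sp = arcs(1,4,7)[THEN arc_imp_simple_path]
  have e_eq: "path_image e - {pathstart e, pathfinish e} = ?e"
    by (rule simple_path_endless[OF arc_imp_simple_path[OF arce]])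
  have conn: "connected ?e"
    using connected_simple_path_endless[OF arc_imp_simple_path[OF arce]] by (simp add: e_eq)
  have ends: "pathstart e \<notin> inside (?A \<union> ?B)" "pathfinish e \<notin> inside (?A \<union> ?B)"
    using e inside_no_overlap[of "?A \<union> ?B"] by blast+
  then have ne: "inside (?A \<union> ?B) \<inter> ?e \<noteq> {}" using ein e_eq by blast
  have av: "(?A \<union> ?B) \<inter> ?e = {}" using ec e_eq by blast
  have "?e \<inter> outside (?A \<union> ?B) = {}"
    using inside_outside_intersect_connected[OF conn ne] av by blast
  then have sub: "?e \<subseteq> inside (?A \<union> ?B)" using av inside_outside[of "?A \<union> ?B"] by blast
  obtain sp1: "inside (?A \<union> ?C) \<inter> inside (?B \<union> ?C) = {}"
    and sp2: "inside (?A \<union> ?C) \<union> inside (?B \<union> ?C) \<union> (?C - {a,b}) = inside (?A \<union> ?B)"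
    by (rule split_inside_simple_closed_curve[OF sp(1) arcs(2,3) sp(2) arcs(5,6) sp(3) arcs(8,9)
          \<open>a \<noteq> b\<close> arcs(10-12) cin])
  have sub2: "?e \<subseteq> inside (?A \<union> ?C) \<union> inside (?B \<union> ?C)"
    using sub sp2 dis e_eq by blast
  note AC = theta_Jordan[OF theta_swap(2)[OF th]]
    and BC = theta_Jordan[OF theta_swap(2)[OF theta_swap(1)[OF th]]]
  have "?e \<subseteq> inside (?A \<union> ?C) \<or> ?e \<subseteq> inside (?B \<union> ?C)"
    using connectedD[OF conn AC(2) BC(2)] sp1 sub2 by blast
  then show False
  proof
    assume "?e \<subseteq> inside (?A \<union> ?C)"
    from end_in_closure_endless(2)[OF _ this]
    have "pathfinish e \<in> inside (?A \<union> ?C) \<union> (?A \<union> ?C)"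
      using arce by (simp add: arc_def closure_Un_frontier AC(5))
    then show False using e out dis arcs(10) pathfinish_in_path_image[of e] by blast
  next
    assume "?e \<subseteq> inside (?B \<union> ?C)"
    from end_in_closure_endless(1)[OF _ this]
    have "pathstart e \<in> inside (?B \<union> ?C) \<union> (?B \<union> ?C)"
      using arce by (simp add: arc_def closure_Un_frontier BC(5))
    then show False using e out dis arcs(10) pathstart_in_path_image[of e] by blast
  qed
qed

section \<open>Paths of a plane drawing\<close>

fun path_edges :: "'a list \<Rightarrow> 'a set set" where
  "path_edges (x # y # xs) = insert {x, y} (path_edges (y # xs))"
| "path_edges xs = {}"

definition path_drawing :: "('a set \<Rightarrow> real \<Rightarrow> complex) \<Rightarrow> 'a list \<Rightarrow> complex set" where
  "path_drawing g xs = (\<Union>e\<in>path_edges xs. path_image (g e))"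

lemma path_edges_append: "path_edges (xs @ y # ys) = path_edges (xs @ [y]) \<union> path_edges (y # ys)"
proof (induction xs)
  case (Cons x xs)
  then show ?case by (cases xs) auto
qed auto

lemma path_edges_rev: "path_edges (rev xs) = path_edges xs"
proof (induction xs rule: path_edges.induct)
  case (1 x y xs)
  have "path_edges (rev (x # y # xs)) = path_edges (rev xs @ [y]) \<union> path_edges [y, x]"
    using path_edges_append[of "rev xs" y "[x]"] by simp
  then show ?case using 1 by (auto simp: insert_commute)
qed auto

lemma path_edges_subset: "e \<in> path_edges xs \<Longrightarrow> e \<subseteq> set xs"
  by (induction xs rule: path_edges.induct) auto

lemma path_edges_in: "successively (\<lambda>u v. {u, v} \<in> E) xs \<Longrightarrow> path_edges xs \<subseteq> E"
  by (induction xs rule: path_edges.induct) auto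

lemma ends_not_path_edge:
  assumes "distinct (x # A @ [y])" "A \<noteq> []"
  shows "{x, y} \<notin> path_edges (x # A @ [y])"
proof -
  obtain a A' where A: "A = a # A'" using assms(2) by (cases A) auto
  show ?thesis using assms path_edges_subset[of "{x,y}" "A @ [y]"] by (auto simp: A doubleton_eq_iff)
qed

lemma successively_append_overlap:
  "successively P (xs @ y # ys) \<longleftrightarrow> successively P (xs @ [y]) \<and> successively P (y # ys)"
  by (auto simp: successively_append_iff)

lemma successively_adj_rev:
  "successively (\<lambda>u v. {u, v} \<in> E) (rev xs) \<longleftrightarrow> successively (\<lambda>u v. {u, v} \<in> E) xs"
  by (simp add: insert_commute)

context
  fixes V :: "'a set" and E :: "'a set set" and p :: "'a \<Rightarrow> complex" and g :: "'a set \<Rightarrow> real \<Rightarrow> complex"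
  assumes graph: "finite_simple_graph V E" and emb: "plane_embedding V E p g"
begin

lemma edge_subset: "e \<in> E \<Longrightarrow> e \<subseteq> V" and edge_card: "e \<in> E \<Longrightarrow> card e = 2"
  using graph by (auto simp: finite_simple_graph_def)

lemma p_inj: "inj_on p V"
  using emb by (simp add: plane_embedding_def)

lemma g_arc: "e \<in> E \<Longrightarrow> arc (g e)"
  using emb by (simp add: plane_embedding_def)

lemma g_ends: "e \<in> E \<Longrightarrow> {pathstart (g e), pathfinish (g e)} = p ` e"
  using emb by (simp add: plane_embedding_def)

lemma vertex_on_edge: "e \<in> E \<Longrightarrow> v \<in> V \<Longrightarrow> p v \<in> path_image (g e) \<longleftrightarrow> v \<in> e"
proof
  assume "e \<in> E" "v \<in> V" "v \<in> e"
  then have "p v \<in> {pathstart (g e), pathfinish (g e)}" by (simp add: g_ends)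
  then show "p v \<in> path_image (g e)" by auto
qed (use emb in \<open>auto simp: plane_embedding_def\<close>)

lemma edges_meet: "e \<in> E \<Longrightarrow> f \<in> E \<Longrightarrow> e \<noteq> f \<Longrightarrow> path_image (g e) \<inter> path_image (g f) \<subseteq> p ` (e \<inter> f)"
  using emb by (simp add: plane_embedding_def)

lemma vertex_in_path_drawing:
  assumes "successively (\<lambda>u v. {u, v} \<in> E) xs" "2 \<le> length xs" "v \<in> set xs"
  shows "p v \<in> path_drawing g xs"
proof -
  have "\<exists>e\<in>path_edges xs. v \<in> e" using assms(2,3)
  proof (induction xs rule: path_edges.induct)
    case (1 x y xs) then show ?case by (cases xs) auto
  qed auto
  then show ?thesis
    using path_edges_in[OF assms(1)] vertex_on_edge edge_subset unfolding path_drawing_def by blast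
qed

lemma edge_disjoint_paths_meet:
  assumes "path_edges xs \<subseteq> E" "path_edges ys \<subseteq> E" "path_edges xs \<inter> path_edges ys = {}"
  shows "path_drawing g xs \<inter> path_drawing g ys \<subseteq> p ` (set xs \<inter> set ys)"
proof
  fix z assume "z \<in> path_drawing g xs \<inter> path_drawing g ys"
  then obtain e f where ef: "e \<in> path_edges xs" "f \<in> path_edges ys"
    "z \<in> path_image (g e) \<inter> path_image (g f)" by (auto simp: path_drawing_def)
  then have "z \<in> p ` (e \<inter> f)" using edges_meet[of e f] assms by blast
  then show "z \<in> p ` (set xs \<inter> set ys)" using path_edges_subset ef by blast
qed

text \<open>
  The arcs of successive edges are joined. The arc of an edge may run in either direction and has to be
  reversed when it does not start at \<open>x\<close>.
\<close>

lemma arc_along_path: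
  assumes "distinct xs" "successively (\<lambda>u v. {u, v} \<in> E) xs" "2 \<le> length xs"
  shows "\<exists>c. arc c \<and> pathstart c = p (hd xs) \<and> pathfinish c = p (last xs) \<and> path_image c = path_drawing g xs"
  using assms
proof (induction xs rule: path_edges.induct)
  case (1 x y xs)
  then have E: "{x, y} \<in> E" by simp
  have "\<exists>c. arc c \<and> pathstart c = p x \<and> pathfinish c = p y \<and> path_image c = path_image (g {x,y})"
  proof (cases "pathstart (g {x,y}) = p x")
    case True
    then show ?thesis using g_ends[OF E] g_arc[OF E] arc_distinct_ends[of "g {x,y}"]
      by (intro exI[of _ "g {x,y}"]) auto
  next
    case False
    then have "pathfinish (g {x,y}) = p x \<and> pathstart (g {x,y}) = p y"
      using g_ends[OF E] by (auto simp: doubleton_eq_iff)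
    then show ?thesis using g_arc[OF E]
      by (intro exI[of _ "reversepath (g {x,y})"]) (auto intro: arc_reversepath)
  qed
  then obtain c where c: "arc c" "pathstart c = p x" "pathfinish c = p y" "path_image c = path_image (g {x,y})"
    by blast
  show ?case
  proof (cases xs)
    case Nil
    then show ?thesis using c by (intro exI[of _ c]) (auto simp: path_drawing_def)
  next
    case (Cons z zs)
    have suc: "successively (\<lambda>u v. {u, v} \<in> E) (y # xs)" using 1 by simp
    obtain d where d: "arc d" "pathstart d = p y" "pathfinish d = p (last xs)" "path_image d = path_drawing g (y # xs)"
      using "1.IH" "1.prems" Cons by auto
    have "{x,y} \<notin> path_edges (y # xs)" using path_edges_subset[of "{x,y}" "y # xs"] 1 by auto
    then have "path_drawing g [x,y] \<inter> path_drawing g (y # xs) \<subseteq> p ` (set [x,y] \<inter> set (y # xs))"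
      using path_edges_in[OF suc] E by (intro edge_disjoint_paths_meet) auto
    then have "path_image c \<inter> path_image d \<subseteq> {p y}"
      using c d 1(2) by (auto simp: path_drawing_def)
    then have "arc (c +++ d)" using c d by (intro arc_join) auto
    then show ?thesis using c d Cons
      by (intro exI[of _ "c +++ d"]) (auto simp: path_image_join path_drawing_def)
  qed
qed auto

text \<open>
  A common edge would have to be \<open>{x, y}\<close>, and this is not an edge of the path through \<open>A\<close> because \<open>A\<close>
  is not empty.
\<close>

lemma internally_disjoint_paths_meet:
  assumes "distinct (x # A @ B @ [y])" "A \<noteq> []"
    and "successively (\<lambda>u v. {u, v} \<in> E) (x # A @ [y])" "successively (\<lambda>u v. {u, v} \<in> E) (x # B @ [y])"
  shows "path_drawing g (x # A @ [y]) \<inter> path_drawing g (x # B @ [y]) = {p x, p y}"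
proof
  have "path_edges (x # A @ [y]) \<inter> path_edges (x # B @ [y]) = {}"
  proof (rule ccontr)
    assume "\<not> ?thesis"
    then obtain e where e: "e \<in> path_edges (x # A @ [y])" "e \<in> path_edges (x # B @ [y])" by blast
    then have "e \<subseteq> set (x # A @ [y])" "e \<subseteq> set (x # B @ [y])"
      by (blast dest: path_edges_subset)+
    then have "e \<subseteq> {x, y}" using assms(1) by auto
    moreover have "card e = 2" using e path_edges_in[OF assms(3)] edge_card by blast
    ultimately have "e = {x, y}" using card_subset_eq[of "{x,y}" e] assms(1) by auto
    then show False using ends_not_path_edge[of x A y] assms e by auto
  qed
  then have "path_drawing g (x # A @ [y]) \<inter> path_drawing g (x # B @ [y]) \<subseteq> p ` (set (x # A @ [y]) \<inter> set (x # B @ [y]))"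
    using path_edges_in[OF assms(3)] path_edges_in[OF assms(4)] by (rule edge_disjoint_paths_meet[rotated 2])
  also have "set (x # A @ [y]) \<inter> set (x # B @ [y]) = {x, y}" using assms(1) by auto
  finally show "path_drawing g (x # A @ [y]) \<inter> path_drawing g (x # B @ [y]) \<subseteq> {p x, p y}" by simp
next
  show "{p x, p y} \<subseteq> path_drawing g (x # A @ [y]) \<inter> path_drawing g (x # B @ [y])"
    using vertex_in_path_drawing[OF assms(3)] vertex_in_path_drawing[OF assms(4)] by simp
qed

lemma theta_of_paths:
  assumes "distinct (x # A @ B @ C @ [y])" "A \<noteq> []" "B \<noteq> []"
    and "successively (\<lambda>u v. {u, v} \<in> E) (x # A @ [y])" "successively (\<lambda>u v. {u, v} \<in> E) (x # B @ [y])"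
      "successively (\<lambda>u v. {u, v} \<in> E) (x # C @ [y])"
  obtains c1 c2 c3 where "theta (p x) (p y) c1 c2 c3" "path_image c1 = path_drawing g (x # A @ [y])"
    "path_image c2 = path_drawing g (x # B @ [y])" "path_image c3 = path_drawing g (x # C @ [y])"
proof -
  obtain c1 where c1: "arc c1" "pathstart c1 = p x" "pathfinish c1 = p y" "path_image c1 = path_drawing g (x # A @ [y])"
    using arc_along_path[of "x # A @ [y]"] assms by auto
  obtain c2 where c2: "arc c2" "pathstart c2 = p x" "pathfinish c2 = p y" "path_image c2 = path_drawing g (x # B @ [y])"
    using arc_along_path[of "x # B @ [y]"] assms by auto
  obtain c3 where c3: "arc c3" "pathstart c3 = p x" "pathfinish c3 = p y" "path_image c3 = path_drawing g (x # C @ [y])"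
    using arc_along_path[of "x # C @ [y]"] assms by auto
  have "theta (p x) (p y) c1 c2 c3"
  proof -
    have "distinct (x # A @ B @ [y])" "distinct (x # A @ C @ [y])" "distinct (x # B @ C @ [y])"
      using assms(1) by auto
    then show ?thesis
      unfolding theta_def using c1 c2 c3 internally_disjoint_paths_meet[of x A B y]
        internally_disjoint_paths_meet[of x A C y] internally_disjoint_paths_meet[of x B C y] assms by simp
  qed
  then show ?thesis using that c1 c2 c3 by blast
qed

lemma path_drawing_in_drawing:
  assumes "path_edges xs \<subseteq> E"
  shows "path_drawing g xs \<subseteq> drawing V E p g"
  using assms by (auto simp: path_drawing_def drawing_def)

lemma vertex_in_interior:
  assumes "successively (\<lambda>u v. {u, v} \<in> E) (x # A @ [y])" "distinct (x # A @ [y])" "t \<in> set A"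
  shows "p t \<in> path_drawing g (x # A @ [y]) - {p x, p y}" "t \<in> V"
proof -
  have V: "w \<in> V" if "w \<in> set (x # A @ [y])" for w
  proof -
    have "\<exists>e\<in>path_edges (x # A @ [y]). w \<in> e" using that
    proof (induction "x # A @ [y]" arbitrary: x A rule: path_edges.induct)
      case (1 x z xs)
      then show ?case by (cases A) auto
    qed auto
    then show ?thesis using path_edges_in[OF assms(1)] edge_subset by blast
  qed
  then show "t \<in> V" using assms(3) by simp
  have "p t \<noteq> p x" "p t \<noteq> p y" using V assms(2,3) inj_onD[OF p_inj] by fastforce+
  then show "p t \<in> path_drawing g (x # A @ [y]) - {p x, p y}"
    using vertex_in_path_drawing[OF assms(1)] assms(3) by simp
qed

context
  assumes outer: "p ` V \<subseteq> frontier (outside (drawing V E p g))"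
begin

text \<open>
  The outside of the whole drawing is contained in the outside of \<open>J\<close>, and each vertex is in the closure of
  the former. The inside of \<open>J\<close> is open and disjoint from the outside of \<open>J\<close>, so it cannot contain such a
  point.
\<close>

lemma vertex_not_inside:
  assumes "v \<in> V" "J \<subseteq> drawing V E p g" "closed J"
  shows "p v \<notin> inside J"
proof
  assume "p v \<in> inside J"
  moreover have "p v \<in> closure (outside J)"
    using assms outer outside_mono[OF assms(2)] closure_mono frontier_def by blast
  ultimately have "inside J \<inter> outside J \<noteq> {}"
    using open_inside[OF assms(3)] open_Int_closure_eq_empty by blast
  then show False by simp
qed

lemma vertex_not_inside_union:
  assumes "v \<in> V" "X \<subseteq> drawing V E p g" "Y \<subseteq> drawing V E p g" "closed X" "closed Y"
  shows "p v \<notin> inside (X \<union> Y)"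
  using assms by (intro vertex_not_inside) auto

text \<open>
  An interior vertex of each path shows that this path does not run through the inside of the closed
  curve formed by the other two, whereas one of three arcs always does.
\<close>

lemma outerplanar_no_theta: "no_theta (\<lambda>u v. {u, v} \<in> E)"
  unfolding no_theta_def
proof (intro allI notI, elim conjE)
  fix x y A B C
  assume dist: "distinct (x # A @ B @ C @ [y])" and ne: "A \<noteq> []" "B \<noteq> []" "C \<noteq> []"
    and A: "successively (\<lambda>u v. {u, v} \<in> E) (x # A @ [y])"
    and B: "successively (\<lambda>u v. {u, v} \<in> E) (x # B @ [y])"
    and C: "successively (\<lambda>u v. {u, v} \<in> E) (x # C @ [y])"
  obtain c1 c2 c3 where th: "theta (p x) (p y) c1 c2 c3" and im: "path_image c1 = path_drawing g (x # A @ [y])"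
    "path_image c2 = path_drawing g (x # B @ [y])" "path_image c3 = path_drawing g (x # C @ [y])"
    using theta_of_paths[OF dist ne(1,2) A B C] .
  have dr: "path_image c1 \<subseteq> drawing V E p g" "path_image c2 \<subseteq> drawing V E p g" "path_image c3 \<subseteq> drawing V E p g"
    unfolding im using path_drawing_in_drawing path_edges_in A B C by blast+
  have cl: "closed (path_image c1)" "closed (path_image c2)" "closed (path_image c3)"
    using theta_arcs[OF th] by (simp_all add: closed_arc_image)
  have d: "distinct (x # A @ [y])" "distinct (x # B @ [y])" "distinct (x # C @ [y])" using dist by auto
  have hd: "hd A \<in> set A" "hd B \<in> set B" "hd C \<in> set C" using ne by auto
  note vA = vertex_in_interior[OF A d(1) hd(1)] and vB = vertex_in_interior[OF B d(2) hd(2)]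
    and vC = vertex_in_interior[OF C d(3) hd(3)]
  note out = vertex_not_inside_union[OF vA(2) dr(2,3) cl(2,3)] vertex_not_inside_union[OF vB(2) dr(1,3) cl(1,3)]
    vertex_not_inside_union[OF vC(2) dr(1,2) cl(1,2)]
  have "path_image c3 \<inter> inside (path_image c1 \<union> path_image c2) \<noteq> {}"
    by (rule theta_arc_inside[OF th vA(1)[folded im] out(1) vB(1)[folded im] out(2)])
  moreover have "path_image c3 \<inter> inside (path_image c1 \<union> path_image c2) = {}"
    by (rule theta_arc_not_inside[OF theta_swap(1)[OF theta_swap(2)[OF th]] vC(1)[folded im] out(3)])
  ultimately show False by simp
qed

text \<open>
  The cycle is cut at \<open>a\<close> and \<open>b\<close> into the paths through \<open>A1\<close> and \<open>A2\<close>, and at \<open>t\<close> and \<open>s\<close> into the paths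
  through \<open>B1\<close> and \<open>B2\<close>. With the chords this gives two theta curves on the same closed curve. The
  vertices \<open>t\<close>, \<open>s\<close> and \<open>a\<close>, \<open>b\<close> show that neither part of the cycle is the inner arc of its theta
  curve, so both chords run inside the cycle.
\<close>

lemma outerplanar_no_crossing: "no_crossing (\<lambda>u v. {u, v} \<in> E)"
  unfolding no_crossing_def
proof (intro allI impI notI, elim conjE)
  fix a B t C b D s F
  assume cyc: "is_cycle (\<lambda>u v. {u, v} \<in> E) (a # B @ t # C @ b # D @ s # F)"
    and ab: "{a, b} \<in> E" and ts: "{t, s} \<in> E"
  let ?adj = "\<lambda>u v. {u, v} \<in> E" and ?P = "successively (\<lambda>u v. {u, v} \<in> E)"
  define A1 where "A1 = B @ t # C"
  define A2 where "A2 = rev F @ s # rev D"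
  define B1 where "B1 = C @ b # D"
  define B2 where "B2 = rev B @ a # rev F"
  have dist: "distinct (a # A1 @ A2 @ [] @ [b])" "distinct (t # B1 @ B2 @ [] @ [s])"
    using cyc by (auto simp: is_cycle_def A1_def A2_def B1_def B2_def)
  note split = successively_append_overlap
  have "?P ((a # B @ t # C @ b # D @ s # F) @ [a])"
    unfolding successively_append_iff using cyc by (simp add: is_cycle_def)
  then have "?P ((a # B) @ t # C @ b # D @ s # F @ [a])" by simp
  then have aBt: "?P (a # B @ [t])" and "?P ((t # C) @ b # D @ s # F @ [a])"
    using split[of ?adj "a # B" t "C @ b # D @ s # F @ [a]"] by (simp_all only: append_Cons simp_thms)
  then have tCb: "?P (t # C @ [b])" and "?P ((b # D) @ s # F @ [a])"
    using split[of ?adj "t # C" b "D @ s # F @ [a]"] by (simp_all only: append_Cons simp_thms)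
  then have bDs: "?P (b # D @ [s])" and sFa: "?P (s # F @ [a])"
    using split[of ?adj "b # D" s "F @ [a]"] by (simp_all only: append_Cons simp_thms)
  have rev: "?P (y # rev xs @ [x])" if "?P (x # xs @ [y])" for x y xs
    using that successively_adj_rev[of E "x # xs @ [y]"] by (simp only: rev.simps rev_append append.simps)
  have p1: "?P (a # A1 @ [b])" and q1: "?P (t # B1 @ [s])"
    using split[of ?adj "a # B" t "C @ [b]"] split[of ?adj "t # C" b "D @ [s]"] aBt tCb bDs
    by (simp_all only: A1_def B1_def append_Cons append_assoc simp_thms)
  have p2: "?P (a # A2 @ [b])" and q2: "?P (t # B2 @ [s])"
    using split[of ?adj "a # rev F" s "rev D @ [b]"] split[of ?adj "t # rev B" a "rev F @ [s]"]
      rev[OF aBt] rev[OF bDs] rev[OF sFa]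
    by (simp_all only: A2_def B2_def append_Cons append_assoc simp_thms)
  obtain c1 c2 c where th: "theta (p a) (p b) c1 c2 c" and im: "path_image c1 = path_drawing g (a # A1 @ [b])"
    "path_image c2 = path_drawing g (a # A2 @ [b])" "path_image c = path_drawing g (a # [] @ [b])"
    by (rule theta_of_paths[OF dist(1) _ _ p1 p2]) (use ab in \<open>simp_all add: A1_def A2_def\<close>)
  obtain d1 d2 e where th': "theta (p t) (p s) d1 d2 e" and im': "path_image d1 = path_drawing g (t # B1 @ [s])"
    "path_image d2 = path_drawing g (t # B2 @ [s])" "path_image e = path_drawing g (t # [] @ [s])"
    by (rule theta_of_paths[OF dist(2) _ _ q1 q2]) (use ts in \<open>simp_all add: B1_def B2_def\<close>)
  have rev_edges: "path_edges (x # rev xs @ [y]) = path_edges (y # xs @ [x])" for x y xs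
    using path_edges_rev[of "y # xs @ [x]"] by simp
  have "path_edges (a # A1 @ [b]) = path_edges (a # B @ [t]) \<union> path_edges (t # C @ [b])"
    using path_edges_append[of "a # B" t "C @ [b]"] by (simp add: A1_def)
  moreover have "path_edges (a # A2 @ [b]) = path_edges (s # F @ [a]) \<union> path_edges (b # D @ [s])"
    using path_edges_append[of "a # rev F" s "rev D @ [b]"] rev_edges[of a F s] rev_edges[of s D b] by (simp add: A2_def)
  moreover have "path_edges (t # B1 @ [s]) = path_edges (t # C @ [b]) \<union> path_edges (b # D @ [s])"
    using path_edges_append[of "t # C" b "D @ [s]"] by (simp add: B1_def)
  moreover have "path_edges (t # B2 @ [s]) = path_edges (a # B @ [t]) \<union> path_edges (s # F @ [a])"
    using path_edges_append[of "t # rev B" a "rev F @ [s]"] rev_edges[of t B a] rev_edges[of a F s] by (simp add: B2_def)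
  ultimately have cycle: "path_image d1 \<union> path_image d2 = path_image c1 \<union> path_image c2"
    unfolding im im' path_drawing_def by blast
  have dr: "path_image c1 \<subseteq> drawing V E p g" "path_image c2 \<subseteq> drawing V E p g" "path_image c \<subseteq> drawing V E p g"
    "path_image d1 \<subseteq> drawing V E p g" "path_image d2 \<subseteq> drawing V E p g" "path_image e \<subseteq> drawing V E p g"
    unfolding im im' using path_drawing_in_drawing path_edges_in p1 p2 q1 q2 ab ts by auto
  have cl: "closed (path_image c1)" "closed (path_image c2)" "closed (path_image c)"
    "closed (path_image d1)" "closed (path_image d2)" "closed (path_image e)"
    using theta_arcs[OF th] theta_arcs[OF th'] by (simp_all add: closed_arc_image)
  have d: "distinct (a # A1 @ [b])" "distinct (a # A2 @ [b])" "distinct (t # B1 @ [s])" "distinct (t # B2 @ [s])"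
    using dist by auto
  have mem: "t \<in> set A1" "s \<in> set A2" "b \<in> set B1" "a \<in> set B2"
    by (auto simp: A1_def A2_def B1_def B2_def)
  note vt = vertex_in_interior[OF p1 d(1) mem(1)] and vs = vertex_in_interior[OF p2 d(2) mem(2)]
  note vb = vertex_in_interior[OF q1 d(3) mem(3)] and va = vertex_in_interior[OF q2 d(4) mem(4)]
  note out = vertex_not_inside_union[OF vt(2) dr(2,3) cl(2,3)] vertex_not_inside_union[OF vs(2) dr(1,3) cl(1,3)]
    vertex_not_inside_union[OF vb(2) dr(5,6) cl(5,6)] vertex_not_inside_union[OF va(2) dr(4,6) cl(4,6)]
  have cin: "path_image c \<inter> inside (path_image c1 \<union> path_image c2) \<noteq> {}"
    by (rule theta_arc_inside[OF th vt(1)[folded im] out(1) vs(1)[folded im] out(2)])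
  have ein: "path_image e \<inter> inside (path_image d1 \<union> path_image d2) \<noteq> {}"
    by (rule theta_arc_inside[OF th' vb(1)[folded im'] out(3) va(1)[folded im'] out(4)])
  have ends: "pathstart e = p t" "pathfinish e = p s" "arc e" using theta_arcs[OF th'] by simp_all
  have "path_image e \<inter> path_image c \<noteq> {}"
  proof (rule chords_inside_cross[OF th ends(3) cin])
    show "path_image e \<inter> (path_image c1 \<union> path_image c2) \<subseteq> {pathstart e, pathfinish e}"
      using theta_arcs(11,12)[OF th'] unfolding cycle[symmetric] ends by blast
    show "path_image e \<inter> inside (path_image c1 \<union> path_image c2) \<noteq> {}"
      using ein by (simp add: cycle)
  qed (use vt(1) vs(1) out(1,2) in \<open>simp_all only: ends im not_False_eq_True\<close>)
  moreover have "path_image e \<inter> path_image c = {}"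
  proof -
    have dj: "{t, s} \<inter> {a, b} = {}" using dist by (auto simp: A1_def A2_def)
    then have "path_image (g {t, s}) \<inter> path_image (g {a, b}) \<subseteq> p ` ({t, s} \<inter> {a, b})"
      using edges_meet[OF ts ab] by (metis Int_absorb insert_not_empty)
    then show ?thesis unfolding im im' dj by (simp add: path_drawing_def)
  qed
  ultimately show False by simp
qed

end

end

theorem theorem1:
  fixes V :: "'a set" and E :: "'a set set"
  assumes "finite_simple_graph V E"
    and "outerplanar V E"
  shows "\<exists>c :: 'a \<times> 'a set \<Rightarrow> nat. incidence_coloring (max_degree V E + 2) 2 V E c"
proof -
  let ?adj = "\<lambda>u v. {u, v} \<in> E"
  obtain p g where emb: "plane_embedding V E p g"
    and outer: "p ` V \<subseteq> frontier (outside (drawing V E p g))"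
    using assms(2) unfolding outerplanar_def by blast
  have fin: "finite V" using assms(1) by (simp add: finite_simple_graph_def)
  have sym: "?adj v u" if "?adj u v" for u v using that by (simp add: insert_commute)
  have irrefl: "\<not> ?adj u u" for u using assms(1) by (auto simp: finite_simple_graph_def)
  have red: "reducible ?adj U" if "U \<subseteq> V" "U \<noteq> {}" for U
    by (rule reducible_if_no_theta_no_crossing[OF sym irrefl outerplanar_no_theta[OF assms(1) emb outer]
          outerplanar_no_crossing[OF assms(1) emb outer] finite_subset[OF that(1) fin] that(2)])
  have deg: "card (nbrs ?adj V v) \<le> max_degree V E" if "v \<in> V" for v
    by (rule card_nbrs_le_max_degree[OF assms(1) that])
  obtain P c where "arc_coloring ?adj (max_degree V E) V P c"
    using arc_coloring_exists[OF sym irrefl fin deg red subset_refl] by blast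
  from incidence_coloring_of_arc_coloring[OF assms(1) this] show ?thesis by blast
qed

end
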